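(* Let $X$ be a stable set of functions on $\Omega$ and let $\mathcal{E}\subseteq\mathcal{P}(X)$ be a stable collection which is closed under finite conditional intersections. Then $\Sigma(\mathcal{E})=\mathcal{D}(\mathcal{E})$, i.e. the stable $\sigma$-algebra generated by $\mathcal{E}$ coincides with the stable Dynkin system generated by $\mathcal{E}$.
   Context: $(\Omega,\mathscr{F},\mathbb{P})$ is a complete probability space; $A,B\in\mathscr{F}$ are identified if $\mathbb{P}(A\Delta B)=0$, and inclusions are understood a.s. A partition (of $\Omega$) is a countable pairwise disjoint family $(A_k)$ in $\mathscr{F}$ with $\bigcup_k A_k=\Omega$. For a function $x$ on $\Omega$ and $A\in\mathscr{F}$, $x|A$ is the restriction of $x$ to $A$; $x|A$ and $y|B$ are identified if $\mathbb{P}(A\Delta B)=0$ and $x=y$ a.e. on $A\cap B$. For a sequence of functions $(x_k)$ and a partition $(A_k)$, $\sum x_k|A_k$ is the function equal to $x_k$ on $A_k$ for each $k$. For a set $X$ of functions on $\Omega$, $X|A:=\{x|A: x\in X\}$, $(X|A)|B:=X|A\cap B$, $X|\emptyset=\{\ast\}$ is a singleton, $X|\Omega=X$. A set $X$ of functions on $\Omega$ with values in a fixed set is stable if $X\neq\emptyset$ and $\sum x_k|A_k\in X$ for all partitions $(A_k)$ and sequences $(x_k)$ in $X$. For a stable set $X$, $\mathcal{P}(X)$ is the collection of all conditional subsets $V|A$, with $V\subseteq X$ stable and $A\in\mathscr{F}$. For stable $V_k\subseteq X$ and a partition $(A_k)$, $\sum V_k|A_k:=\{\sum x_k|A_k: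 x_k\in V_k \text{ for all } k\}$, and concatenations in $\mathcal{P}(X)$ are defined by $\sum (V_k|B_k)|A_k:=(\sum V_k|A_k)|\bigcup_k(A_k\cap B_k)$. A subset of $\mathcal{P}(X)$ is a stable collection if it is nonempty and closed under such countable concatenations. Conditional inclusion: $V|A\sqsubseteq W|B$ iff $A\subseteq B$ and $V|A\subseteq W|A$. $(\mathcal{P}(X),\sqsubseteq)$ is a complete Boolean algebra with greatest element $X$ and least element $\{\ast\}=X|\emptyset$; $\sqcup,\sqcap,{}^\sqsubset$ (conditional union, intersection, complement) denote its supremum, infimum and complement. $V|A$ and $W|B$ are disjoint if $V|A\sqcap W|B=\{\ast\}$. A stable collection $\mathcal{X}\subseteq\mathcal{P}(X)$ is a stable Dynkin system if $X\in\mathcal{X}$, it is closed under ${}^\sqsubset$, and $\sqcup_k(V_k|A_k)\in\mathcal{X}$ for all sequences of pairwise disjoint elements of $\mathcal{X}$; it is a stable $\sigma$-algebra if $X\in\mathcal{X}$, it is closed under ${}^\sqsubset$, and $\sqcup_k(V_k|A_k)\in\mathcal{X}$ for all sequences in $\mathcal{X}$. $\mathcal{D}(\mathcal{E})$ (resp. $\Sigma(\mathcal{E})$) is the smallest stable Dynkin system (resp. stable $\sigma$-algebra) containing $\mathcal{E}$. *)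

theory Defs
  imports "HOL-Probability.Probability" "HOL-Algebra.Complete_Lattice"
begin

section \<open>Restrictions of functions, partitions and concatenations\<close>

text \<open>
  \<^term>\<open>frestr M A x\<close> is the restriction of \<open>x\<close> to \<open>A\<close>, taken modulo the identification of
  \<open>x|A\<close> with \<open>y|B\<close> whenever \<open>A\<close> and \<open>B\<close> differ by a null set and \<open>x = y\<close> almost everywhere on
  \<open>A \<inter> B\<close>: it is the equivalence class of the pair \<open>(A, x)\<close>.  The fixed set in which
  the functions take their values is the type variable \<open>'e\<close>; no measurability is required
  of them.
\<close>

definition frestr :: "'w measure \<Rightarrow> 'w set \<Rightarrow> ('w \<Rightarrow> 'e) \<Rightarrow> ('w set \<times> ('w \<Rightarrow> 'e)) set" where
  "frestr M A x =
    {(B, y). B \<in> sets M \<and> (AE w in M. w \<in> A \<longleftrightarrow> w \<in> B) \<and> (AE w in M. w \<in> A \<inter> B \<longrightarrow> x w = y w)}"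

lemma frestr_eq_iff:
  assumes "A \<in> sets M" "B \<in> sets M"
  shows "frestr M A x = frestr M B y \<longleftrightarrow>
    (AE w in M. w \<in> A \<longleftrightarrow> w \<in> B) \<and> (AE w in M. w \<in> A \<inter> B \<longrightarrow> x w = y w)"
    (is "?L \<longleftrightarrow> ?R")
proof
  assume ?L
  moreover have "(B, y) \<in> frestr M B y"
    using assms by (simp add: frestr_def)
  ultimately have "(B, y) \<in> frestr M A x"
    by simp
  then show ?R
    by (simp add: frestr_def)
next
  assume R: ?R
  have "(C, z) \<in> frestr M A x \<longleftrightarrow> (C, z) \<in> frestr M B y" for C z
  proof
    assume "(C, z) \<in> frestr M A x"
    then have C: "C \<in> sets M" "AE w in M. w \<in> A \<longleftrightarrow> w \<in> C"
      "AE w in M. w \<in> A \<inter> C \<longrightarrow> x w = z w"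
      by (simp_all add: frestr_def)
    have "AE w in M. w \<in> B \<longleftrightarrow> w \<in> C"
      using R[THEN conjunct1] C(2) by eventually_elim auto
    moreover have "AE w in M. w \<in> B \<inter> C \<longrightarrow> y w = z w"
      using R[THEN conjunct1] R[THEN conjunct2] C(2,3) by eventually_elim auto
    ultimately show "(C, z) \<in> frestr M B y"
      using C(1) by (simp add: frestr_def)
  next
    assume "(C, z) \<in> frestr M B y"
    then have C: "C \<in> sets M" "AE w in M. w \<in> B \<longleftrightarrow> w \<in> C"
      "AE w in M. w \<in> B \<inter> C \<longrightarrow> y w = z w"
      by (simp_all add: frestr_def)
    have "AE w in M. w \<in> A \<longleftrightarrow> w \<in> C"
      using R[THEN conjunct1] C(2) by eventually_elim auto
    moreover have "AE w in M. w \<in> A \<inter> C \<longrightarrow> x w = z w"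
      using R[THEN conjunct1] R[THEN conjunct2] C(2,3) by eventually_elim auto
    ultimately show "(C, z) \<in> frestr M A x"
      using C(1) by (simp add: frestr_def)
  qed
  then show ?L
    by auto
qed

definition srestr :: "'w measure \<Rightarrow> ('w \<Rightarrow> 'e) set \<Rightarrow> 'w set \<Rightarrow> ('w set \<times> ('w \<Rightarrow> 'e)) set set" where
  "srestr M V A = frestr M A ` V"

text \<open>Finite partitions are covered as well, since the sets \<open>A k\<close> may be empty.\<close>

definition mpartition :: "'w measure \<Rightarrow> (nat \<Rightarrow> 'w set) \<Rightarrow> bool" where
  "mpartition M A \<longleftrightarrow> range A \<subseteq> sets M \<and> disjoint_family A \<and> (\<Union>k. A k) = space M"

text \<open>The values outside of \<open>\<Union>k. A k\<close>, i.e. outside of \<open>space M\<close>, are irrelevant.\<close>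

definition glue :: "(nat \<Rightarrow> 'w set) \<Rightarrow> (nat \<Rightarrow> 'w \<Rightarrow> 'e) \<Rightarrow> 'w \<Rightarrow> 'e" where
  "glue A x w = x (THE k. w \<in> A k) w"

definition glue_sets :: "(nat \<Rightarrow> 'w set) \<Rightarrow> (nat \<Rightarrow> ('w \<Rightarrow> 'e) set) \<Rightarrow> ('w \<Rightarrow> 'e) set" where
  "glue_sets A V = {glue A x | x. \<forall>k. x k \<in> V k}"

text \<open>
  As functions are identified when they agree almost everywhere, membership of a concatenation
  in \<open>X\<close> means that it agrees almost everywhere with an element of \<open>X\<close>.
\<close>

definition stable_set :: "'w measure \<Rightarrow> ('w \<Rightarrow> 'e) set \<Rightarrow> bool" where
  "stable_set M X \<longleftrightarrow> X \<noteq> {} \<and>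
    (\<forall>A x. mpartition M A \<and> (\<forall>k. x k \<in> X) \<longrightarrow> (\<exists>y\<in>X. AE w in M. y w = glue A x w))"


section \<open>The conditional power set\<close>

definition cond_Pow :: "'w measure \<Rightarrow> ('w \<Rightarrow> 'e) set \<Rightarrow> ('w set \<times> ('w \<Rightarrow> 'e)) set set set" where
  "cond_Pow M X = {srestr M V A | V A. V \<subseteq> X \<and> stable_set M V \<and> A \<in> sets M}"

definition cond_le ::
  "'w measure \<Rightarrow> ('w \<Rightarrow> 'e) set \<Rightarrow> ('w set \<times> ('w \<Rightarrow> 'e)) set set \<Rightarrow> ('w set \<times> ('w \<Rightarrow> 'e)) set set \<Rightarrow> bool"
where
  "cond_le M X P Q \<longleftrightarrow> (\<exists>V A W B.
     V \<subseteq> X \<and> stable_set M V \<and> A \<in> sets M \<and> P = srestr M V A \<and>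
     W \<subseteq> X \<and> stable_set M W \<and> B \<in> sets M \<and> Q = srestr M W B \<and>
     (AE w in M. w \<in> A \<longrightarrow> w \<in> B) \<and> srestr M V A \<subseteq> srestr M W A)"

text \<open>
  Conditional union and intersection are the supremum and infimum (\<open>\<Squnion>\<close>, \<open>\<Sqinter>\<close>, \<open>\<squnion>\<close>, \<open>\<sqinter>\<close>) of
  this ordered set.
\<close>

definition cond_order :: "'w measure \<Rightarrow> ('w \<Rightarrow> 'e) set \<Rightarrow> ('w set \<times> ('w \<Rightarrow> 'e)) set set gorder" where
  "cond_order M X = \<lparr>carrier = cond_Pow M X, eq = (=), le = cond_le M X\<rparr>"

definition cond_compl ::
  "'w measure \<Rightarrow> ('w \<Rightarrow> 'e) set \<Rightarrow> ('w set \<times> ('w \<Rightarrow> 'e)) set set \<Rightarrow> ('w set \<times> ('w \<Rightarrow> 'e)) set set"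
where
  "cond_compl M X P = (THE Q. Q \<in> cond_Pow M X \<and>
     P \<squnion>\<^bsub>cond_order M X\<^esub> Q = srestr M X (space M) \<and>
     P \<sqinter>\<^bsub>cond_order M X\<^esub> Q = srestr M X {})"

definition cond_disjoint ::
  "'w measure \<Rightarrow> ('w \<Rightarrow> 'e) set \<Rightarrow> ('w set \<times> ('w \<Rightarrow> 'e)) set set \<Rightarrow> ('w set \<times> ('w \<Rightarrow> 'e)) set set \<Rightarrow> bool"
where
  "cond_disjoint M X P Q \<longleftrightarrow> P \<sqinter>\<^bsub>cond_order M X\<^esub> Q = srestr M X {}"


section \<open>Stable Dynkin systems and stable \<open>\<sigma>\<close>-algebras\<close>

text \<open>
  The concatenation of \<open>V\<^sub>k|B\<^sub>k\<close> along \<open>A\<^sub>k\<close> only depends on the classes \<open>V\<^sub>k|B\<^sub>k\<close>, so closedness may be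
  required for all their representations.
\<close>

definition stable_collection ::
  "'w measure \<Rightarrow> ('w \<Rightarrow> 'e) set \<Rightarrow> ('w set \<times> ('w \<Rightarrow> 'e)) set set set \<Rightarrow> bool"
where
  "stable_collection M X \<X> \<longleftrightarrow> \<X> \<subseteq> cond_Pow M X \<and> \<X> \<noteq> {} \<and>
    (\<forall>A V B. mpartition M A \<and>
       (\<forall>k. V k \<subseteq> X \<and> stable_set M (V k) \<and> B k \<in> sets M \<and> srestr M (V k) (B k) \<in> \<X>) \<longrightarrow>
       srestr M (glue_sets A V) (\<Union>k. A k \<inter> B k) \<in> \<X>)"

definition stable_dynkin ::
  "'w measure \<Rightarrow> ('w \<Rightarrow> 'e) set \<Rightarrow> ('w set \<times> ('w \<Rightarrow> 'e)) set set set \<Rightarrow> bool"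
where
  "stable_dynkin M X \<X> \<longleftrightarrow> stable_collection M X \<X> \<and>
    srestr M X (space M) \<in> \<X> \<and>
    (\<forall>P\<in>\<X>. cond_compl M X P \<in> \<X>) \<and>
    (\<forall>P. range P \<subseteq> \<X> \<and> (\<forall>i j :: nat. i \<noteq> j \<longrightarrow> cond_disjoint M X (P i) (P j)) \<longrightarrow>
      \<Squnion>\<^bsub>cond_order M X\<^esub> (range P) \<in> \<X>)"

definition stable_sigma_algebra ::
  "'w measure \<Rightarrow> ('w \<Rightarrow> 'e) set \<Rightarrow> ('w set \<times> ('w \<Rightarrow> 'e)) set set set \<Rightarrow> bool"
where
  "stable_sigma_algebra M X \<X> \<longleftrightarrow> stable_collection M X \<X> \<and>
    srestr M X (space M) \<in> \<X> \<and>
    (\<forall>P\<in>\<X>. cond_compl M X P \<in> \<X>) \<and>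
    (\<forall>P :: nat \<Rightarrow> _. range P \<subseteq> \<X> \<longrightarrow> \<Squnion>\<^bsub>cond_order M X\<^esub> (range P) \<in> \<X>)"

definition gen_stable_dynkin ::
  "'w measure \<Rightarrow> ('w \<Rightarrow> 'e) set \<Rightarrow> ('w set \<times> ('w \<Rightarrow> 'e)) set set set \<Rightarrow> ('w set \<times> ('w \<Rightarrow> 'e)) set set set"
where
  "gen_stable_dynkin M X \<E> = \<Inter>{\<X>. stable_dynkin M X \<X> \<and> \<E> \<subseteq> \<X>}"

definition gen_stable_sigma_algebra ::
  "'w measure \<Rightarrow> ('w \<Rightarrow> 'e) set \<Rightarrow> ('w set \<times> ('w \<Rightarrow> 'e)) set set set \<Rightarrow> ('w set \<times> ('w \<Rightarrow> 'e)) set set set"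
where
  "gen_stable_sigma_algebra M X \<E> = \<Inter>{\<X>. stable_sigma_algebra M X \<X> \<and> \<E> \<subseteq> \<X>}"

end

theory Submission
  imports Defs
begin

text \<open>Membership of a function \<open>x\<close> in a conditional set \<open>V|A\<close> is a matter of degree: among the events
  \<open>C\<close> with \<open>x|C \<in> (V|A)|C\<close> there is, up to a null set, a largest one \<open>u x\<close>.  It exists because such
  events are stable under countable unions (this is where the stability of \<open>V\<close> enters) and a family
  of events with this property in a finite measure space has an essentially largest member.
  
  The map \<open>u\<close> from \<open>X\<close> to events is extensional: on an event where \<open>x\<close> and \<open>y\<close> agree, \<open>u x\<close> and
  \<open>u y\<close> agree too.  Conversely, gluing shows that every extensional map comes from a conditional set: its
  domain \<open>A\<close> is the essentially largest event contained in some \<open>u x\<close>, and it consists of all \<open>x\<close> with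
  \<open>A \<subseteq> u x\<close>.  Conditional inclusion is the pointwise inclusion of the maps modulo null sets.
  Extensionality survives complements, intersections and countable unions, so the operations of
  \<open>\<P>(X)\<close> are the pointwise set operations, and a concatenation of \<open>P\<^sub>k\<close> along \<open>A\<^sub>k\<close> corresponds to
  \<open>\<Union>\<^sub>k A\<^sub>k \<inter> u\<^sub>k x\<close>.  All identities of Boolean algebra are thereby reduced to identities between
  events, taken almost everywhere; the lemmas \<open>represents_*\<close> carry out this translation.
  
  With it the classical \<open>\<pi>\<close>-\<open>\<lambda>\<close> argument applies.  For \<open>P\<close> in a stable Dynkin system \<open>\<D>\<close>, the \<open>Q\<close> with
  \<open>P \<sqinter> Q \<in> \<D>\<close> form a stable Dynkin system (\<open>stable_dynkin_meet_slice\<close>); only closedness under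
  concatenations goes beyond the classical case, and it holds because intersection with \<open>P\<close>
  distributes over concatenation.  Applied twice to \<open>\<D>(\<E>)\<close>, first with \<open>P\<close> in \<open>\<E>\<close>, this
  shows that \<open>\<D>(\<E>)\<close> is closed under binary intersections.  Disjointifying a sequence then makes it a stable
  \<open>\<sigma>\<close>-algebra, whence \<open>\<Sigma>(\<E>) \<subseteq> \<D>(\<E>)\<close>; the other inclusion holds because stable \<open>\<sigma>\<close>-algebras are
  stable Dynkin systems.\<close>

section \<open>Gluing along partitions\<close>

lemma glue_apply:
  assumes "disjoint_family A" "w \<in> A k"
  shows "glue A x w = x k w"
proof -
  have "(THE j. w \<in> A j) = k"
    using assms by (intro the_equality) (auto simp: disjoint_family_on_def)
  then show ?thesis
    by (simp add: glue_def)
qed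

lemma AE_eq_glue_iff:
  assumes "mpartition M A"
  shows "(AE w in M. y w = glue A x w) \<longleftrightarrow> (\<forall>k. AE w in M. w \<in> A k \<longrightarrow> y w = x k w)"
proof -
  have "(y w = glue A x w) \<longleftrightarrow> (\<forall>k. w \<in> A k \<longrightarrow> y w = x k w)" if "w \<in> space M" for w
  proof -
    obtain k where "w \<in> A k"
      using assms \<open>w \<in> space M\<close> unfolding mpartition_def by blast
    moreover have "disjoint_family A"
      using assms unfolding mpartition_def by blast
    ultimately show ?thesis
      using glue_apply[of A w _ x] by metis
  qed
  then have "(AE w in M. y w = glue A x w) \<longleftrightarrow> (AE w in M. \<forall>k. w \<in> A k \<longrightarrow> y w = x k w)"
    by (intro AE_cong) auto
  then show ?thesis
    by (simp add: AE_all_countable)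
qed

lemma stable_set_glue:
  assumes V: "stable_set M V" and D: "mpartition M D" and x: "\<And>k. x k \<in> V"
  obtains y where "y \<in> V" "\<And>k. AE w in M. w \<in> D k \<longrightarrow> y w = x k w"
proof -
  obtain y where y: "y \<in> V" "AE w in M. y w = glue D x w"
    using V D x unfolding stable_set_def by blast
  have "AE w in M. w \<in> D k \<longrightarrow> y w = x k w" for k
    using y(2) unfolding AE_eq_glue_iff[OF D] by (rule spec)
  with y(1) show ?thesis
    by (rule that)
qed

text \<open>A countable cover by measurable sets is made disjoint, and what it leaves uncovered is
  filled with one more cell; hence a single stable function can be found that on almost every
  point of the union agrees with some \<open>x k\<close> available there.\<close>

lemma stable_set_glue_cover:
  assumes V: "stable_set M V" and C: "\<And>k::nat. C k \<in> sets M" and x: "\<And>k. x k \<in> V"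
  obtains y D where "y \<in> V" "\<And>k. D k \<in> sets M" "\<And>k. D k \<subseteq> C k" "(\<Union>k. D k) = (\<Union>k. C k)"
    "\<And>k. AE w in M. w \<in> D k \<longrightarrow> y w = x k w"
proof -
  define D where "D = disjointed C"
  define E where "E k = (case k of 0 \<Rightarrow> space M - (\<Union>k. C k) | Suc j \<Rightarrow> D j)" for k
  have D: "D k \<in> sets M" "D k \<subseteq> C k" for k
    using sets.range_disjointed_sets[of C M] C disjointed_subset[of C k]
    unfolding D_def by auto
  have UD: "(\<Union>k. D k) = (\<Union>k. C k)"
    unfolding D_def by (rule UN_disjointed_eq)
  have dD: "disjoint_family D"
    unfolding D_def by (rule disjoint_family_disjointed)
  have "mpartition M E"
    unfolding mpartition_def
  proof (intro conjI)
    show "range E \<subseteq> sets M"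
      using C D(1) by (auto simp: E_def split: nat.split)
    show "disjoint_family E"
      using dD UD unfolding disjoint_family_on_def E_def by (auto split: nat.split)
    have "(\<Union>k. E k) = E 0 \<union> (\<Union>k. E (Suc k))"
      by (auto, metis not0_implies_Suc)
    also have "\<dots> = (space M - (\<Union>k. C k)) \<union> (\<Union>k. C k)"
      using UD by (simp add: E_def)
    also have "\<dots> = space M"
      using C[THEN sets.sets_into_space] by blast
    finally show "(\<Union>k. E k) = space M" .
  qed
  \<comment> \<open>The cell \<open>E 0\<close> is the uncovered rest, where any element serves; truncated subtraction picks \<open>x 0\<close>.\<close>
  then obtain y where y: "y \<in> V" "\<And>k. AE w in M. w \<in> E k \<longrightarrow> y w = x (k - 1) w"
    using stable_set_glue[OF V _, of E "\<lambda>k. x (k - 1)"] x by blast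
  have "AE w in M. w \<in> D k \<longrightarrow> y w = x k w" for k
    using y(2)[of "Suc k"] by (simp add: E_def)
  with y(1) D UD show ?thesis
    using that by blast
qed

text \<open>A concatenation of functions from \<open>X\<close> lies in \<open>X\<close> only up to a null set, so \<^term>\<open>glue_sets A V\<close> need
  not be a subset of \<open>X\<close>.  The set \<open>W\<close> of genuine elements of \<open>X\<close> that look like \<open>V k\<close> on each
  cell has the same restrictions, which makes a concatenation a member of \<^const>\<open>cond_Pow\<close>.\<close>

lemma glue_sets_representatives:
  assumes X: "stable_set M X" and A: "mpartition M A"
    and V: "\<And>k. V k \<subseteq> X" "\<And>k. stable_set M (V k)"
  defines "W \<equiv> {y \<in> X. \<forall>k. \<exists>v\<in>V k. AE w in M. w \<in> A k \<longrightarrow> y w = v w}"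
  shows "stable_set M W" "C \<in> sets M \<Longrightarrow> srestr M (glue_sets A V) C = srestr M W C"
proof -
  show "stable_set M W"
    unfolding stable_set_def
  proof (intro conjI allI impI)
    have "\<exists>v. v \<in> V k" for k
      using V(2)[of k] unfolding stable_set_def by blast
    then obtain v where v: "\<And>k. v k \<in> V k"
      by metis
    obtain y where "y \<in> X" "\<And>k. AE w in M. w \<in> A k \<longrightarrow> y w = v k w"
      using stable_set_glue[OF X A, of v] v V(1) by blast
    then have "y \<in> W"
      using v unfolding W_def by blast
    then show "W \<noteq> {}"
      by blast
  next
    fix D and x :: "nat \<Rightarrow> _" assume D: "mpartition M D \<and> (\<forall>n. x n \<in> W)"
    then have xW: "\<And>n. x n \<in> W"
      by blast
    obtain y where y: "y \<in> X" "\<And>n. AE w in M. w \<in> D n \<longrightarrow> y w = x n w"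
      using stable_set_glue[OF X, of D x] D unfolding W_def by blast
    have "\<exists>v\<in>V k. AE w in M. w \<in> A k \<longrightarrow> y w = v w" for k
    proof -
      have "\<exists>v. v \<in> V k \<and> (AE w in M. w \<in> A k \<longrightarrow> x n w = v w)" for n
        using xW[of n] unfolding W_def by blast
      then obtain v where v: "\<And>n. v n \<in> V k" "\<And>n. AE w in M. w \<in> A k \<longrightarrow> x n w = v n w"
        by metis
      obtain z where z: "z \<in> V k" "\<And>n. AE w in M. w \<in> D n \<longrightarrow> z w = v n w"
        using stable_set_glue[OF V(2), of D v k] D v(1) by blast
      have "AE w in M. \<forall>n. (w \<in> D n \<longrightarrow> y w = x n w) \<and> (w \<in> A k \<longrightarrow> x n w = v n w) \<and>
          (w \<in> D n \<longrightarrow> z w = v n w)"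
        using y(2) v(2) z(2) by (simp add: AE_all_countable)
      then have "AE w in M. w \<in> A k \<longrightarrow> y w = z w"
        using AE_space
      proof eventually_elim
        case (elim w)
        then obtain n where "w \<in> D n"
          using D unfolding mpartition_def by blast
        with elim show ?case
          by metis
      qed
      with z(1) show ?thesis
        by blast
    qed
    then have "y \<in> W"
      using y(1) unfolding W_def by blast
    moreover have "AE w in M. y w = glue D x w"
      using AE_eq_glue_iff D y(2) by blast
    ultimately show "\<exists>y\<in>W. AE w in M. y w = glue D x w"
      by blast
  qed
  show "srestr M (glue_sets A V) C = srestr M W C" if C: "C \<in> sets M"
  proof -
    have same: "frestr M C y = frestr M C z" if "AE w in M. y w = z w"
      for y z :: "'a \<Rightarrow> 'b"
      using that C by (subst frestr_eq_iff) auto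
    show ?thesis
    proof (intro subset_antisym subsetI)
      fix p assume "p \<in> srestr M (glue_sets A V) C"
      then obtain v where v: "\<And>k. v k \<in> V k" "p = frestr M C (glue A v)"
        unfolding srestr_def glue_sets_def by blast
      obtain y where y: "y \<in> X" "\<And>k. AE w in M. w \<in> A k \<longrightarrow> y w = v k w"
        using stable_set_glue[OF X A, of v] v V(1) by blast
      then have "y \<in> W"
        using v unfolding W_def by blast
      moreover have "AE w in M. y w = glue A v w"
        using AE_eq_glue_iff[OF A] y(2) by blast
      ultimately show "p \<in> srestr M W C"
        using same v(2) unfolding srestr_def by blast
    next
      fix p assume "p \<in> srestr M W C"
      then obtain y where y: "y \<in> W" "p = frestr M C y"
        unfolding srestr_def by blast
      then have "\<forall>k. \<exists>v. v \<in> V k \<and> (AE w in M. w \<in> A k \<longrightarrow> y w = v w)"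
        unfolding W_def by blast
      then obtain v where v: "\<And>k. v k \<in> V k" "\<And>k. AE w in M. w \<in> A k \<longrightarrow> y w = v k w"
        by metis
      have "AE w in M. y w = glue A v w"
        using AE_eq_glue_iff[OF A] v(2) by blast
      moreover have "glue A v \<in> glue_sets A V"
        using v(1) unfolding glue_sets_def by blast
      ultimately show "p \<in> srestr M (glue_sets A V) C"
        using same y(2) unfolding srestr_def by blast
    qed
  qed
qed

section \<open>Exhaustion\<close>

text \<open>Take members of \<open>F\<close> whose measures approach the supremum \<open>s\<close> over \<open>F\<close>.  Their union \<open>U\<close> is a member
  of measure \<open>s\<close>, and a member exceeding \<open>U\<close> by a non-null set would, joined with \<open>U\<close>,
  have measure greater than \<open>s\<close>.\<close>

lemma (in finite_measure) exhaustion: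
  assumes F: "F \<subseteq> sets M" "F \<noteq> {}"
    and UN: "\<And>C. (\<And>k::nat. C k \<in> F) \<Longrightarrow> (\<Union>k. C k) \<in> F"
  obtains U where "U \<in> F" "\<And>C. C \<in> F \<Longrightarrow> AE w in M. w \<in> C \<longrightarrow> w \<in> U"
proof -
  define s where "s = Sup (measure M ` F)"
  have bdd: "bdd_above (measure M ` F)"
    by (intro bdd_aboveI[of _ "measure M (space M)"]) (auto intro: bounded_measure)
  have le: "measure M C \<le> s" if "C \<in> F" for C
    unfolding s_def using bdd that by (intro cSup_upper) auto
  have "\<exists>C. C \<in> F \<and> s - 1 / Suc n < measure M C" for n
    using less_cSup_iff[of "measure M ` F" "s - 1 / Suc n"] bdd F(2) unfolding s_def by auto
  then obtain C where C: "\<And>n. C n \<in> F" "\<And>n::nat. s - 1 / Suc n < measure M (C n)"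
    by metis
  define U where "U = (\<Union>n. C n)"
  have U: "U \<in> F"
    unfolding U_def using C(1) by (rule UN)
  have "s \<le> measure M U"
  proof (rule field_le_epsilon)
    fix e :: real assume "0 < e"
    then obtain n where n: "1 / Suc n < e"
      using nat_approx_posE by blast
    have "measure M (C n) \<le> measure M U"
      using F(1) C(1) U by (intro finite_measure_mono) (auto simp: U_def)
    then show "s \<le> measure M U + e"
      using C(2)[of n] n by linarith
  qed
  moreover have "AE w in M. w \<in> D \<longrightarrow> w \<in> U" if "s \<le> measure M U" "D \<in> F" for D
  proof -
    have sets: "D \<in> sets M" "U \<in> sets M"
      using F(1) U that by auto
    have "(\<Union>k::nat. if k = 0 then D else U) \<in> F"
      using U that by (intro UN) auto
    moreover have "(\<Union>k::nat. if k = 0 then D else U) = U \<union> (D - U)"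
      by (auto split: if_splits)
    ultimately have "measure M (U \<union> (D - U)) \<le> s"
      using le by metis
    moreover have "measure M (U \<union> (D - U)) = measure M U + measure M (D - U)"
      using sets by (intro finite_measure_Union) auto
    ultimately have "measure M (D - U) = 0"
      using that measure_nonneg[of M "D - U"] by linarith
    then have "emeasure M (D - U) = 0"
      by (simp add: emeasure_eq_measure)
    then have "D - U \<in> null_sets M"
      using sets by (intro null_setsI) auto
    then have "AE w in M. w \<notin> D - U"
      by (rule AE_not_in)
    then show ?thesis
      by eventually_elim auto
  qed
  ultimately show ?thesis
    using that U by blast
qed

section \<open>Conditional sets as extensional families of events\<close>

text \<open>This says \<open>x|C \<in> P|C\<close>, that is, that some \<open>y|B\<close> in \<open>P\<close> restricts to \<open>x|C\<close>.  Quantifying over all pairs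
  that occur in the classes of \<open>P\<close> avoids any choice of a representation \<open>P = V|A\<close>.\<close>

definition covers ::
  "'w measure \<Rightarrow> ('w set \<times> ('w \<Rightarrow> 'e)) set set \<Rightarrow> 'w set \<Rightarrow> ('w \<Rightarrow> 'e) \<Rightarrow> bool"
where
  "covers M P C x \<longleftrightarrow> (\<exists>(B, y)\<in>\<Union>P. (AE w in M. w \<in> C \<longrightarrow> w \<in> B) \<and> (AE w in M. w \<in> C \<longrightarrow> x w = y w))"

lemma covers_srestr:
  assumes A: "A \<in> sets M"
  shows "covers M (srestr M V A) C x \<longleftrightarrow>
    (AE w in M. w \<in> C \<longrightarrow> w \<in> A) \<and> (\<exists>v\<in>V. AE w in M. w \<in> C \<longrightarrow> x w = v w)"
    (is "?L \<longleftrightarrow> ?R")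
proof
  assume ?L
  then obtain v B y where v: "v \<in> V" "(B, y) \<in> frestr M A v"
    and C: "AE w in M. w \<in> C \<longrightarrow> w \<in> B" "AE w in M. w \<in> C \<longrightarrow> x w = y w"
    unfolding covers_def srestr_def by blast
  have B: "AE w in M. w \<in> A \<longleftrightarrow> w \<in> B" "AE w in M. w \<in> A \<inter> B \<longrightarrow> v w = y w"
    using v(2) unfolding frestr_def by auto
  have "AE w in M. w \<in> C \<longrightarrow> w \<in> A"
    using B(1) C(1) by eventually_elim auto
  moreover have "AE w in M. w \<in> C \<longrightarrow> x w = v w"
    using B C by eventually_elim auto
  ultimately show ?R
    using v(1) by blast
next
  assume ?R
  then obtain v where v: "v \<in> V" "AE w in M. w \<in> C \<longrightarrow> w \<in> A" "AE w in M. w \<in> C \<longrightarrow> x w = v w"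
    by blast
  moreover have "(A, v) \<in> frestr M A v"
    using A unfolding frestr_def by simp
  ultimately show ?L
    unfolding covers_def srestr_def by blast
qed

lemma covers_cong:
  assumes "covers M P C x" "AE w in M. w \<in> C' \<longrightarrow> w \<in> C" "AE w in M. w \<in> C' \<longrightarrow> x w = y w"
  shows "covers M P C' y"
proof -
  obtain B z where z: "(B, z) \<in> \<Union>P" "AE w in M. w \<in> C \<longrightarrow> w \<in> B" "AE w in M. w \<in> C \<longrightarrow> x w = z w"
    using assms(1) unfolding covers_def by blast
  have "AE w in M. w \<in> C' \<longrightarrow> w \<in> B"
    using assms(2) z(2) by eventually_elim auto
  moreover have "AE w in M. w \<in> C' \<longrightarrow> y w = z w"
    using assms(2,3) z(3) by eventually_elim auto
  ultimately show ?thesis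
    using z(1) unfolding covers_def by blast
qed

locale stable_space = prob_space M for M :: "'w measure" +
  fixes X :: "('w \<Rightarrow> 'e) set"
  assumes stable_X: "stable_set M X"
begin

text \<open>The event \<open>u x\<close> is the largest one, up to a null set, on which \<open>x\<close> belongs to \<open>P\<close>; thus \<open>u\<close> is the
  characteristic function of \<open>P\<close> with values in the measure algebra.  It is kept as a map to actual
  events, unique modulo null sets, so that set operations apply to it directly.\<close>

definition represents ::
  "('w set \<times> ('w \<Rightarrow> 'e)) set set \<Rightarrow> (('w \<Rightarrow> 'e) \<Rightarrow> 'w set) \<Rightarrow> bool"
where
  "represents P u \<longleftrightarrow> P \<in> cond_Pow M X \<and> (\<forall>x\<in>X. u x \<in> sets M \<and>
     (\<forall>C\<in>sets M. covers M P C x \<longleftrightarrow> (AE w in M. w \<in> C \<longrightarrow> w \<in> u x)))"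

text \<open>Events on which two functions agree need not be measurable when no structure is assumed on the values, so
  agreement of \<open>u x\<close> and \<open>u y\<close> where \<open>x = y\<close> is tested on measurable sets \<open>C\<close>.\<close>

definition extensional_family :: "(('w \<Rightarrow> 'e) \<Rightarrow> 'w set) \<Rightarrow> bool" where
  "extensional_family u \<longleftrightarrow> (\<forall>x\<in>X. u x \<in> sets M) \<and>
     (\<forall>x\<in>X. \<forall>y\<in>X. \<forall>C\<in>sets M. (AE w in M. w \<in> C \<longrightarrow> w \<in> u x) \<longrightarrow>
       (AE w in M. w \<in> C \<longrightarrow> x w = y w) \<longrightarrow> (AE w in M. w \<in> C \<longrightarrow> w \<in> u y))"

lemma cond_PowE:
  assumes "P \<in> cond_Pow M X"
  obtains V A where "V \<subseteq> X" "stable_set M V" "A \<in> sets M" "P = srestr M V A"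
  using assms unfolding cond_Pow_def by blast

lemma cond_PowI: "V \<subseteq> X \<Longrightarrow> stable_set M V \<Longrightarrow> A \<in> sets M \<Longrightarrow> srestr M V A \<in> cond_Pow M X"
  unfolding cond_Pow_def by blast

lemma represents_cond_Pow: "represents P u \<Longrightarrow> P \<in> cond_Pow M X"
  unfolding represents_def by blast

lemma represents_sets: "represents P u \<Longrightarrow> x \<in> X \<Longrightarrow> u x \<in> sets M"
  unfolding represents_def by blast

lemma represents_covers:
  "represents P u \<Longrightarrow> x \<in> X \<Longrightarrow> C \<in> sets M \<Longrightarrow>
    covers M P C x \<longleftrightarrow> (AE w in M. w \<in> C \<longrightarrow> w \<in> u x)"
  unfolding represents_def by blast

lemma represents_extensional:
  assumes "represents P u"
  shows "extensional_family u"
  unfolding extensional_family_def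
proof (intro conjI ballI impI)
  fix x y C
  assume *: "x \<in> X" "y \<in> X" "C \<in> sets M" "AE w in M. w \<in> C \<longrightarrow> w \<in> u x"
    "AE w in M. w \<in> C \<longrightarrow> x w = y w"
  then have "covers M P C x"
    using represents_covers[OF assms] by blast
  then have "covers M P C y"
    using * by (elim covers_cong) auto
  then show "AE w in M. w \<in> C \<longrightarrow> w \<in> u y"
    using represents_covers[OF assms] * by blast
qed (use assms represents_sets in blast)

text \<open>The form in which extensionality passes through the pointwise set operations: the implication from
  \<open>w \<in> u x\<close> to \<open>w \<in> u y\<close> holds at almost every single point of \<open>C\<close>, so that such statements for several
  families can be combined pointwise.\<close>

lemma extensional_familyD:
  assumes "extensional_family u" "x \<in> X" "y \<in> X" "C \<in> sets M"
    "AE w in M. w \<in> C \<longrightarrow> x w = y w"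
  shows "AE w in M. w \<in> C \<longrightarrow> w \<in> u x \<longrightarrow> w \<in> u y"
proof -
  have "u x \<in> sets M"
    using assms unfolding extensional_family_def by blast
  then have "C \<inter> u x \<in> sets M"
    using assms(4) by blast
  moreover have "AE w in M. w \<in> C \<inter> u x \<longrightarrow> x w = y w"
    using assms(5) by eventually_elim auto
  moreover have "AE w in M. w \<in> C \<inter> u x \<longrightarrow> w \<in> u x"
    by simp
  ultimately have "AE w in M. w \<in> C \<inter> u x \<longrightarrow> w \<in> u y"
    using assms(1-3) unfolding extensional_family_def by blast
  then show ?thesis
    by eventually_elim auto
qed

lemma extensional_familyI:
  assumes "\<And>x. x \<in> X \<Longrightarrow> u x \<in> sets M"
    and "\<And>x y C. x \<in> X \<Longrightarrow> y \<in> X \<Longrightarrow> C \<in> sets M \<Longrightarrow> AE w in M. w \<in> C \<longrightarrow> x w = y w \<Longrightarrow>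
      AE w in M. w \<in> C \<longrightarrow> w \<in> u x \<longrightarrow> w \<in> u y"
  shows "extensional_family u"
  unfolding extensional_family_def
proof (intro conjI ballI impI)
  fix x y C
  assume *: "x \<in> X" "y \<in> X" "C \<in> sets M" "AE w in M. w \<in> C \<longrightarrow> w \<in> u x"
    "AE w in M. w \<in> C \<longrightarrow> x w = y w"
  show "AE w in M. w \<in> C \<longrightarrow> w \<in> u y"
    using assms(2)[OF *(1,2,3,5)] *(4) by eventually_elim auto
qed (use assms(1) in blast)

text \<open>If \<open>x\<close> agrees on \<open>C k\<close> with a member \<open>v k\<close> of \<open>V\<close>, then on \<open>\<Union>k. C k\<close> it agrees with a
  concatenation of the \<open>v k\<close>, which is in \<open>V\<close> by stability.  Exhaustion therefore applies to the
  events covered by \<open>x\<close>.\<close>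

lemma cond_Pow_represents:
  assumes P: "P \<in> cond_Pow M X"
  obtains u where "represents P u"
proof -
  obtain V A where V: "V \<subseteq> X" "stable_set M V" "A \<in> sets M" "P = srestr M V A"
    using P by (rule cond_PowE)
  note cov = covers_srestr[OF V(3), of V]
  have "\<exists>U. U \<in> sets M \<and> (\<forall>C\<in>sets M. covers M P C x \<longleftrightarrow> (AE w in M. w \<in> C \<longrightarrow> w \<in> U))" for x
  proof -
    define F where "F = {C \<in> sets M. covers M P C x}"
    obtain v where v: "v \<in> V"
      using V(2) unfolding stable_set_def by blast
    have "{} \<in> F"
      using v unfolding F_def V(4) by (auto simp: cov)
    moreover have "(\<Union>k. C k) \<in> F" if "\<And>k::nat. C k \<in> F" for C
    proof -
      have C: "C k \<in> sets M" "AE w in M. w \<in> C k \<longrightarrow> w \<in> A"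
        "\<exists>v. v \<in> V \<and> (AE w in M. w \<in> C k \<longrightarrow> x w = v w)" for k
        using that[of k] unfolding F_def V(4) cov by auto
      then obtain v where v: "\<And>k. v k \<in> V" "\<And>k. AE w in M. w \<in> C k \<longrightarrow> x w = v k w"
        by metis
      obtain y D where D: "y \<in> V" "\<And>k. D k \<in> sets M" "\<And>k. D k \<subseteq> C k" "(\<Union>k. D k) = (\<Union>k. C k)"
        "\<And>k. AE w in M. w \<in> D k \<longrightarrow> y w = v k w"
        using stable_set_glue_cover[of M V C v] V(2) C(1) v(1) by blast
      have "AE w in M. \<forall>k. (w \<in> C k \<longrightarrow> x w = v k w) \<and> (w \<in> D k \<longrightarrow> y w = v k w) \<and>
          (w \<in> C k \<longrightarrow> w \<in> A)"
        using v(2) D(5) C(2) by (simp add: AE_all_countable)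
      then have "AE w in M. w \<in> (\<Union>k. C k) \<longrightarrow> w \<in> A \<and> x w = y w"
      proof eventually_elim
        case (elim w)
        show ?case
        proof
          assume "w \<in> (\<Union>k. C k)"
          then obtain k where "w \<in> D k"
            unfolding D(4)[symmetric] by blast
          then show "w \<in> A \<and> x w = y w"
            using elim D(3)[of k] by (metis subsetD)
        qed
      qed
      then have "AE w in M. w \<in> (\<Union>k. C k) \<longrightarrow> w \<in> A" "AE w in M. w \<in> (\<Union>k. C k) \<longrightarrow> x w = y w"
        by (eventually_elim, blast)+
      then have "covers M P (\<Union>k. C k) x"
        unfolding V(4) cov using D(1) by blast
      then show ?thesis
        unfolding F_def using C(1) by blast
    qed
    ultimately obtain U where U: "U \<in> F" "\<And>C. C \<in> F \<Longrightarrow> AE w in M. w \<in> C \<longrightarrow> w \<in> U"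
      using exhaustion[of F] unfolding F_def by blast
    have "covers M P C x" if "C \<in> sets M" "AE w in M. w \<in> C \<longrightarrow> w \<in> U" for C
      using U(1) that unfolding F_def by (auto intro: covers_cong)
    then show ?thesis
      using U unfolding F_def by blast
  qed
  then obtain u where "\<And>x. u x \<in> sets M \<and> (\<forall>C\<in>sets M. covers M P C x \<longleftrightarrow> (AE w in M. w \<in> C \<longrightarrow> w \<in> u x))"
    by metis
  then have "represents P u"
    using P unfolding represents_def by blast
  then show ?thesis
    by (rule that)
qed

text \<open>Every extensional family is the characteristic function of some \<open>V|A\<close>.  By gluing, the events
  contained in some \<open>u x\<close> are closed under countable unions; an essentially largest one, \<open>A \<subseteq> u a\<close>, has to be the
  domain, and \<open>V = {x. A \<subseteq> u x}\<close>.  An arbitrary \<open>x\<close> belongs to \<open>V|A\<close> on all of \<open>u x\<close> because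
  \<open>x\<close> can be completed outside \<open>u x\<close> by \<open>a\<close> to an element of \<open>V\<close>.\<close>

lemma extensional_family_represents:
  assumes u: "extensional_family u"
  obtains P where "represents P u"
proof -
  have us: "u x \<in> sets M" if "x \<in> X" for x
    using u that unfolding extensional_family_def by blast
  define F where "F = {C \<in> sets M. \<exists>x\<in>X. AE w in M. w \<in> C \<longrightarrow> w \<in> u x}"
  obtain x0 where x0: "x0 \<in> X"
    using stable_X unfolding stable_set_def by blast
  then have "{} \<in> F"
    unfolding F_def by auto
  moreover have "(\<Union>k. C k) \<in> F" if "\<And>k::nat. C k \<in> F" for C
  proof -
    have C: "C k \<in> sets M" "\<exists>x. x \<in> X \<and> (AE w in M. w \<in> C k \<longrightarrow> w \<in> u x)" for k
      using that[of k] unfolding F_def by auto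
    then obtain x where x: "\<And>k. x k \<in> X" "\<And>k. AE w in M. w \<in> C k \<longrightarrow> w \<in> u (x k)"
      by metis
    obtain y D where D: "y \<in> X" "\<And>k. D k \<in> sets M" "\<And>k. D k \<subseteq> C k" "(\<Union>k. D k) = (\<Union>k. C k)"
      "\<And>k. AE w in M. w \<in> D k \<longrightarrow> y w = x k w"
      using stable_set_glue_cover[of M X C x] stable_X C(1) x(1) by blast
    have "AE w in M. w \<in> D k \<longrightarrow> w \<in> u (x k) \<longrightarrow> w \<in> u y" for k
    proof (rule extensional_familyD[OF u])
      show "AE w in M. w \<in> D k \<longrightarrow> x k w = y w"
        using D(5)[of k] by eventually_elim auto
    qed (use x D in auto)
    then have "AE w in M. \<forall>k. (w \<in> D k \<longrightarrow> w \<in> u (x k) \<longrightarrow> w \<in> u y) \<and> (w \<in> C k \<longrightarrow> w \<in> u (x k))"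
      using x(2) by (simp add: AE_all_countable)
    then have "AE w in M. w \<in> (\<Union>k. C k) \<longrightarrow> w \<in> u y"
      unfolding D(4)[symmetric] by eventually_elim (use D(3) in blast)
    then show ?thesis
      unfolding F_def using C(1) D(1) by blast
  qed
  ultimately obtain A where A: "A \<in> F" "\<And>C. C \<in> F \<Longrightarrow> AE w in M. w \<in> C \<longrightarrow> w \<in> A"
    using exhaustion[of F] unfolding F_def by blast
  then obtain a where a: "a \<in> X" "AE w in M. w \<in> A \<longrightarrow> w \<in> u a" and As: "A \<in> sets M"
    unfolding F_def by blast
  define V where "V = {x \<in> X. AE w in M. w \<in> A \<longrightarrow> w \<in> u x}"
  have "stable_set M V"
    unfolding stable_set_def
  proof (intro conjI allI impI)
    show "V \<noteq> {}"
      using a unfolding V_def by blast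
  next
    fix D and x :: "nat \<Rightarrow> _" assume D: "mpartition M D \<and> (\<forall>k. x k \<in> V)"
    then have x: "x k \<in> X" "AE w in M. w \<in> A \<longrightarrow> w \<in> u (x k)" for k
      unfolding V_def by auto
    have Ds: "D k \<in> sets M" for k
      using D unfolding mpartition_def by blast
    obtain y where y: "y \<in> X" "\<And>k. AE w in M. w \<in> D k \<longrightarrow> y w = x k w"
      using stable_set_glue[OF stable_X, of D x] D x(1) by blast
    have "AE w in M. w \<in> D k \<longrightarrow> w \<in> u (x k) \<longrightarrow> w \<in> u y" for k
    proof (rule extensional_familyD[OF u])
      show "AE w in M. w \<in> D k \<longrightarrow> x k w = y w"
        using y(2)[of k] by eventually_elim auto
    qed (use x y Ds in auto)
    then have "AE w in M. \<forall>k. (w \<in> D k \<longrightarrow> w \<in> u (x k) \<longrightarrow> w \<in> u y) \<and> (w \<in> A \<longrightarrow> w \<in> u (x k))"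
      using x(2) by (simp add: AE_all_countable)
    then have "AE w in M. w \<in> A \<longrightarrow> w \<in> u y"
      using AE_space by eventually_elim (use D in \<open>unfold mpartition_def, blast\<close>)
    then have "y \<in> V"
      using y(1) unfolding V_def by blast
    moreover have "AE w in M. y w = glue D x w"
      using AE_eq_glue_iff D y(2) by blast
    ultimately show "\<exists>y\<in>V. AE w in M. y w = glue D x w"
      by blast
  qed
  then have P: "srestr M V A \<in> cond_Pow M X"
    using As by (intro cond_PowI) (auto simp: V_def)
  have "covers M (srestr M V A) C x \<longleftrightarrow> (AE w in M. w \<in> C \<longrightarrow> w \<in> u x)"
    if x: "x \<in> X" and C: "C \<in> sets M" for x C
    unfolding covers_srestr[OF As]
  proof
    assume "(AE w in M. w \<in> C \<longrightarrow> w \<in> A) \<and> (\<exists>v\<in>V. AE w in M. w \<in> C \<longrightarrow> x w = v w)"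
    then obtain v where v: "v \<in> X" "AE w in M. w \<in> A \<longrightarrow> w \<in> u v" "AE w in M. w \<in> C \<longrightarrow> x w = v w"
      and CA: "AE w in M. w \<in> C \<longrightarrow> w \<in> A"
      unfolding V_def by blast
    have "AE w in M. w \<in> C \<longrightarrow> v w = x w"
      using v(3) by eventually_elim auto
    then have "AE w in M. w \<in> C \<longrightarrow> w \<in> u v \<longrightarrow> w \<in> u x"
      using extensional_familyD[OF u v(1) x C] by blast
    then show "AE w in M. w \<in> C \<longrightarrow> w \<in> u x"
      using v(2) CA by eventually_elim auto
  next
    assume Cu: "AE w in M. w \<in> C \<longrightarrow> w \<in> u x"
    then have "C \<in> F"
      using C x unfolding F_def by blast
    then have CA: "AE w in M. w \<in> C \<longrightarrow> w \<in> A"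
      by (rule A(2))
    \<comment> \<open>The witness in \<open>V\<close> follows \<open>x\<close> on \<open>C\<close> and \<open>a\<close> off \<open>C\<close>, so it covers all of \<open>A\<close>.\<close>
    define D :: "nat \<Rightarrow> 'w set" where "D k = (if k = 0 then C else if k = 1 then space M - C else {})" for k
    have UD: "(\<Union>k. D k) = space M"
    proof
      show "(\<Union>k. D k) \<subseteq> space M"
        using sets.sets_into_space[OF C] by (auto simp: D_def)
      have "space M \<subseteq> D 0 \<union> D 1"
        by (auto simp: D_def)
      then show "space M \<subseteq> (\<Union>k. D k)"
        by blast
    qed
    have D: "mpartition M D"
      unfolding mpartition_def
      using C UD by (auto simp: D_def disjoint_family_on_def)
    obtain v where v: "v \<in> X" "\<And>k. AE w in M. w \<in> D k \<longrightarrow> v w = (if k = 0 then x else a) w"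
      by (rule stable_set_glue[OF stable_X D, of "\<lambda>k. if k = 0 then x else a"]) (use x a(1) in auto)
    have v0: "AE w in M. w \<in> C \<longrightarrow> x w = v w"
      using v(2)[of 0] unfolding D_def by eventually_elim simp
    have v1: "AE w in M. w \<in> space M - C \<longrightarrow> a w = v w"
      using v(2)[of 1] unfolding D_def by eventually_elim simp
    have "AE w in M. w \<in> C \<longrightarrow> w \<in> u x \<longrightarrow> w \<in> u v"
      using extensional_familyD[OF u x v(1) C v0] .
    moreover have "AE w in M. w \<in> space M - C \<longrightarrow> w \<in> u a \<longrightarrow> w \<in> u v"
      using extensional_familyD[OF u a(1) v(1) _ v1] C by blast
    ultimately have "AE w in M. w \<in> A \<longrightarrow> w \<in> u v"
      using a(2) Cu AE_space by eventually_elim auto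
    then have "v \<in> V"
      using v(1) unfolding V_def by blast
    with CA v0 show "(AE w in M. w \<in> C \<longrightarrow> w \<in> A) \<and> (\<exists>v\<in>V. AE w in M. w \<in> C \<longrightarrow> x w = v w)"
      by blast
  qed
  then have "represents (srestr M V A) u"
    using P us unfolding represents_def by blast
  then show ?thesis
    by (rule that)
qed

lemma cond_le_iff:
  assumes P: "represents P u" and Q: "represents Q v"
  shows "cond_le M X P Q \<longleftrightarrow> (\<forall>x\<in>X. AE w in M. w \<in> u x \<longrightarrow> w \<in> v x)"
proof
  assume "cond_le M X P Q"
  then obtain V A W B where V: "V \<subseteq> X" "A \<in> sets M" "P = srestr M V A"
    and W: "W \<subseteq> X" "B \<in> sets M" "Q = srestr M W B"
    and AB: "AE w in M. w \<in> A \<longrightarrow> w \<in> B" and sub: "srestr M V A \<subseteq> srestr M W A"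
    unfolding cond_le_def by blast
  show "\<forall>x\<in>X. AE w in M. w \<in> u x \<longrightarrow> w \<in> v x"
  proof
    fix x assume x: "x \<in> X"
    note ux = represents_sets[OF P x]
    have "covers M P (u x) x"
      using represents_covers[OF P x ux] by simp
    then obtain y where y: "y \<in> V" "AE w in M. w \<in> u x \<longrightarrow> x w = y w"
      and uA: "AE w in M. w \<in> u x \<longrightarrow> w \<in> A"
      unfolding V(3) covers_srestr[OF V(2)] by blast
    obtain z where z: "z \<in> W" "frestr M A y = frestr M A z"
      using sub y(1) unfolding srestr_def by blast
    then have "AE w in M. w \<in> A \<longrightarrow> y w = z w"
      using frestr_eq_iff[OF V(2) V(2), of y z] by simp
    then have "AE w in M. w \<in> u x \<longrightarrow> x w = z w"
      using y(2) uA by eventually_elim auto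
    moreover have "AE w in M. w \<in> u x \<longrightarrow> w \<in> B"
      using uA AB by eventually_elim auto
    ultimately have "covers M Q (u x) x"
      unfolding W(3) covers_srestr[OF W(2)] using z(1) by blast
    then show "AE w in M. w \<in> u x \<longrightarrow> w \<in> v x"
      using represents_covers[OF Q x ux] by blast
  qed
next
  assume le: "\<forall>x\<in>X. AE w in M. w \<in> u x \<longrightarrow> w \<in> v x"
  obtain V A where V: "V \<subseteq> X" "stable_set M V" "A \<in> sets M" "P = srestr M V A"
    using represents_cond_Pow[OF P] by (rule cond_PowE)
  obtain W B where W: "W \<subseteq> X" "stable_set M W" "B \<in> sets M" "Q = srestr M W B"
    using represents_cond_Pow[OF Q] by (rule cond_PowE)
  have *: "(AE w in M. w \<in> A \<longrightarrow> w \<in> B) \<and> (\<exists>z\<in>W. AE w in M. w \<in> A \<longrightarrow> y w = z w)"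
    if y: "y \<in> V" for y
  proof -
    have yX: "y \<in> X"
      using y V(1) by blast
    have "covers M P A y"
      unfolding V(4) covers_srestr[OF V(3)] using y by auto
    then have "AE w in M. w \<in> A \<longrightarrow> w \<in> u y"
      using represents_covers[OF P yX V(3)] by blast
    moreover have "AE w in M. w \<in> u y \<longrightarrow> w \<in> v y"
      using le yX by blast
    ultimately have "AE w in M. w \<in> A \<longrightarrow> w \<in> v y"
      by eventually_elim auto
    then have "covers M Q A y"
      using represents_covers[OF Q yX V(3)] by blast
    then show ?thesis
      unfolding W(4) covers_srestr[OF W(3)] .
  qed
  have "V \<noteq> {}"
    using V(2) unfolding stable_set_def by blast
  then have AB: "AE w in M. w \<in> A \<longrightarrow> w \<in> B"
    using * by blast
  have "srestr M V A \<subseteq> srestr M W A"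
  proof
    fix p assume "p \<in> srestr M V A"
    then obtain y where y: "y \<in> V" "p = frestr M A y"
      unfolding srestr_def by blast
    then obtain z where "z \<in> W" "AE w in M. w \<in> A \<longrightarrow> y w = z w"
      using * by blast
    then show "p \<in> srestr M W A"
      using y(2) frestr_eq_iff[OF V(3) V(3), of y z] unfolding srestr_def by auto
  qed
  then show "cond_le M X P Q"
    unfolding cond_le_def using V W AB by blast
qed

text \<open>Mutual inclusion forces the domains to coincide up to a null set, since the domain of a nonempty class
  of restrictions is determined by the class; then the restrictions themselves are the same.\<close>

lemma cond_le_antisym:
  assumes "cond_le M X P Q" "cond_le M X Q P"
  shows "P = Q"
proof -
  have *: "P \<subseteq> Q" if PQ: "cond_le M X P Q" and QP: "cond_le M X Q P" for P Q
  proof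
    fix p assume p: "p \<in> P"
    obtain V A W B where V: "V \<subseteq> X" "A \<in> sets M" "P = srestr M V A"
      and W: "W \<subseteq> X" "B \<in> sets M" "Q = srestr M W B" "stable_set M W"
      and AB: "AE w in M. w \<in> A \<longrightarrow> w \<in> B" and sub: "srestr M V A \<subseteq> srestr M W A"
      using PQ unfolding cond_le_def by blast
    obtain V' A' W' B' where V': "V' \<subseteq> X" "A' \<in> sets M" "Q = srestr M V' A'" "stable_set M V'"
      and W': "W' \<subseteq> X" "B' \<in> sets M" "P = srestr M W' B'"
      and AB': "AE w in M. w \<in> A' \<longrightarrow> w \<in> B'"
      using QP unfolding cond_le_def by blast
    have dom: "AE w in M. w \<in> C \<longleftrightarrow> w \<in> D"
      if "srestr M S C = srestr M T D" "stable_set M S" "C \<in> sets M" "D \<in> sets M" for S T C D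
    proof -
      obtain s where "s \<in> S"
        using \<open>stable_set M S\<close> unfolding stable_set_def by blast
      then have "frestr M C s \<in> frestr M D ` T"
        using that(1) unfolding srestr_def by (metis imageI)
      then obtain t where "frestr M C s = frestr M D t"
        by blast
      then show ?thesis
        using frestr_eq_iff[OF that(3,4)] by blast
    qed
    have BA': "AE w in M. w \<in> B \<longleftrightarrow> w \<in> A'"
      using dom[of W B V' A'] W V' by simp
    obtain y where y: "y \<in> V" "p = frestr M A y"
      using p V(3) unfolding srestr_def by blast
    obtain y' where y': "frestr M A y = frestr M B' y'"
      using y p W'(3) unfolding srestr_def by blast
    have "AE w in M. w \<in> A \<longleftrightarrow> w \<in> B'"
      using y' frestr_eq_iff[OF V(2) W'(2)] by blast
    then have BA: "AE w in M. w \<in> A \<longleftrightarrow> w \<in> B"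
      using AB AB' BA' by eventually_elim blast
    obtain z where z: "z \<in> W" "frestr M A y = frestr M A z"
      using sub y(1) unfolding srestr_def by blast
    then have "AE w in M. w \<in> A \<longrightarrow> y w = z w"
      using frestr_eq_iff[OF V(2) V(2), of y z] by simp
    then have "frestr M A y = frestr M B z"
      using BA by (subst frestr_eq_iff[OF V(2) W(2)]) (auto elim: AE_mp)
    then show "p \<in> Q"
      using y(2) z(1) W(3) unfolding srestr_def by blast
  qed
  show ?thesis
    using *[OF assms] *[OF assms(2,1)] by blast
qed

text \<open>The principle by which all identities between conditional sets are proved below: it suffices to
  compare characteristic functions almost everywhere.\<close>

lemma represents_unique:
  assumes "represents P u" "represents Q v" "\<And>x. x \<in> X \<Longrightarrow> AE w in M. w \<in> u x \<longleftrightarrow> w \<in> v x"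
  shows "P = Q"
proof (rule cond_le_antisym)
  show "cond_le M X P Q"
    unfolding cond_le_iff[OF assms(1,2)]
  proof
    fix x assume "x \<in> X"
    from assms(3)[OF this] show "AE w in M. w \<in> u x \<longrightarrow> w \<in> v x"
      by eventually_elim blast
  qed
  show "cond_le M X Q P"
    unfolding cond_le_iff[OF assms(2,1)]
  proof
    fix x assume "x \<in> X"
    from assms(3)[OF this] show "AE w in M. w \<in> v x \<longrightarrow> w \<in> u x"
      by eventually_elim blast
  qed
qed

section \<open>The conditional set operations are pointwise\<close>

lemma represents_top: "represents (srestr M X (space M)) (\<lambda>x. space M)"
proof -
  have "covers M (srestr M X (space M)) C x \<longleftrightarrow> (AE w in M. w \<in> C \<longrightarrow> w \<in> space M)"
    if "x \<in> X" for C x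
    unfolding covers_srestr[OF sets.top] using that by auto
  then show ?thesis
    unfolding represents_def using stable_X by (auto intro: cond_PowI)
qed

lemma represents_bot: "represents (srestr M X {}) (\<lambda>x. {})"
proof -
  have "covers M (srestr M X {}) C x \<longleftrightarrow> (AE w in M. w \<in> C \<longrightarrow> w \<in> {})"
    if "x \<in> X" for C x
    unfolding covers_srestr[OF sets.empty_sets] using that by (auto elim: AE_mp)
  then show ?thesis
    unfolding represents_def using stable_X by (auto intro: cond_PowI)
qed

text \<open>Suprema and infima of an ordered structure are chosen by Hilbert's operator; antisymmetry of
  conditional inclusion makes the choice unique.\<close>

lemma sup_eqI:
  assumes "S \<in> cond_Pow M X" "F \<subseteq> cond_Pow M X" "\<And>P. P \<in> F \<Longrightarrow> cond_le M X P S"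
    "\<And>T. T \<in> cond_Pow M X \<Longrightarrow> (\<And>P. P \<in> F \<Longrightarrow> cond_le M X P T) \<Longrightarrow> cond_le M X S T"
  shows "\<Squnion>\<^bsub>cond_order M X\<^esub> F = S"
proof -
  have "Upper (cond_order M X) F = {T \<in> cond_Pow M X. \<forall>P\<in>F. cond_le M X P T}"
    using assms(2) unfolding Upper_def cond_order_def by auto
  then have least: "least (cond_order M X) S (Upper (cond_order M X) F)"
    using assms(1,3,4) by (simp add: least_def) (simp add: cond_order_def)
  show ?thesis
    unfolding Lattice.sup_def
  proof (rule some_equality)
    show "least (cond_order M X) S (Upper (cond_order M X) F)"
      by (rule least)
  next
    fix T assume "least (cond_order M X) T (Upper (cond_order M X) F)"
    then have "cond_le M X T S" "cond_le M X S T"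
      using least unfolding least_def by (auto simp: cond_order_def)
    then show "T = S"
      by (rule cond_le_antisym)
  qed
qed

lemma inf_eqI:
  assumes "S \<in> cond_Pow M X" "F \<subseteq> cond_Pow M X" "\<And>P. P \<in> F \<Longrightarrow> cond_le M X S P"
    "\<And>T. T \<in> cond_Pow M X \<Longrightarrow> (\<And>P. P \<in> F \<Longrightarrow> cond_le M X T P) \<Longrightarrow> cond_le M X T S"
  shows "\<Sqinter>\<^bsub>cond_order M X\<^esub> F = S"
proof -
  have "Lower (cond_order M X) F = {T \<in> cond_Pow M X. \<forall>P\<in>F. cond_le M X T P}"
    using assms(2) unfolding Lower_def cond_order_def by auto
  then have greatest: "greatest (cond_order M X) S (Lower (cond_order M X) F)"
    using assms(1,3,4) by (simp add: greatest_def) (simp add: cond_order_def)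
  show ?thesis
    unfolding Lattice.inf_def
  proof (rule some_equality)
    show "greatest (cond_order M X) S (Lower (cond_order M X) F)"
      by (rule greatest)
  next
    fix T assume "greatest (cond_order M X) T (Lower (cond_order M X) F)"
    then have "cond_le M X T S" "cond_le M X S T"
      using greatest unfolding greatest_def by (auto simp: cond_order_def)
    then show "T = S"
      by (rule cond_le_antisym)
  qed
qed

text \<open>Only countable suprema are treated: for an uncountable family the pointwise union would not
  respect null sets.\<close>

lemma represents_Sup:
  assumes P: "\<And>k::nat. represents (P k) (u k)"
  shows "represents (\<Squnion>\<^bsub>cond_order M X\<^esub> (range P)) (\<lambda>x. \<Union>k. u k x)"
proof -
  have "extensional_family (\<lambda>x. \<Union>k. u k x)"
  proof (rule extensional_familyI)
    show "(\<Union>k. u k x) \<in> sets M" if "x \<in> X" for x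
      using represents_sets[OF P that] by blast
    fix x y C assume "x \<in> X" "y \<in> X" "C \<in> sets M" "AE w in M. w \<in> C \<longrightarrow> x w = y w"
    note extensional_familyD[OF represents_extensional[OF P] this]
    then have "AE w in M. \<forall>k. w \<in> C \<longrightarrow> w \<in> u k x \<longrightarrow> w \<in> u k y"
      unfolding AE_all_countable by (rule allI)
    then show "AE w in M. w \<in> C \<longrightarrow> w \<in> (\<Union>k. u k x) \<longrightarrow> w \<in> (\<Union>k. u k y)"
      by eventually_elim auto
  qed
  then obtain S where S: "represents S (\<lambda>x. \<Union>k. u k x)"
    by (rule extensional_family_represents)
  have "\<Squnion>\<^bsub>cond_order M X\<^esub> (range P) = S"
  proof (rule sup_eqI)
    show "cond_le M X Q S" if "Q \<in> range P" for Q
      using that cond_le_iff[OF P S] by auto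
    fix T assume T: "T \<in> cond_Pow M X" "\<And>Q. Q \<in> range P \<Longrightarrow> cond_le M X Q T"
    obtain t where t: "represents T t"
      using T(1) by (rule cond_Pow_represents)
    have "AE w in M. w \<in> (\<Union>k. u k x) \<longrightarrow> w \<in> t x" if "x \<in> X" for x
    proof -
      have "AE w in M. \<forall>k. w \<in> u k x \<longrightarrow> w \<in> t x"
        unfolding AE_all_countable using T(2) that cond_le_iff[OF P t] by blast
      then show ?thesis
        by eventually_elim auto
    qed
    then show "cond_le M X S T"
      using cond_le_iff[OF S t] by blast
  qed (use represents_cond_Pow P S in auto)
  with S show ?thesis
    by simp
qed

lemma represents_join:
  assumes "represents P u" "represents Q v"
  shows "represents (P \<squnion>\<^bsub>cond_order M X\<^esub> Q) (\<lambda>x. u x \<union> v x)"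
proof -
  have "represents (\<Squnion>\<^bsub>cond_order M X\<^esub> (range (\<lambda>k::nat. if k = 0 then P else Q)))
      (\<lambda>x. \<Union>k::nat. (if k = 0 then u else v) x)"
    using assms by (intro represents_Sup) auto
  moreover have "range (\<lambda>k::nat. if k = 0 then P else Q) = {P, Q}"
    by auto
  moreover have "(\<Union>k::nat. (if k = 0 then u else v) x) = u x \<union> v x" for x
    by (auto split: if_splits)
  ultimately show ?thesis
    by (simp add: join_def)
qed

lemma represents_meet:
  assumes P: "represents P u" and Q: "represents Q v"
  shows "represents (P \<sqinter>\<^bsub>cond_order M X\<^esub> Q) (\<lambda>x. u x \<inter> v x)"
proof -
  have "extensional_family (\<lambda>x. u x \<inter> v x)"
  proof (rule extensional_familyI)
    show "u x \<inter> v x \<in> sets M" if "x \<in> X" for x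
      using represents_sets[OF P that] represents_sets[OF Q that] by blast
    fix x y C assume "x \<in> X" "y \<in> X" "C \<in> sets M" "AE w in M. w \<in> C \<longrightarrow> x w = y w"
    note * = extensional_familyD[OF represents_extensional[OF P] this]
      extensional_familyD[OF represents_extensional[OF Q] this]
    show "AE w in M. w \<in> C \<longrightarrow> w \<in> u x \<inter> v x \<longrightarrow> w \<in> u y \<inter> v y"
      using * by eventually_elim auto
  qed
  then obtain S where S: "represents S (\<lambda>x. u x \<inter> v x)"
    by (rule extensional_family_represents)
  have "P \<sqinter>\<^bsub>cond_order M X\<^esub> Q = S"
    unfolding meet_def
  proof (rule inf_eqI)
    show "cond_le M X S R" if "R \<in> {P, Q}" for R
      using that cond_le_iff[OF S P] cond_le_iff[OF S Q] by auto
    fix T assume T: "T \<in> cond_Pow M X" "\<And>R. R \<in> {P, Q} \<Longrightarrow> cond_le M X T R"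
    obtain t where t: "represents T t"
      using T(1) by (rule cond_Pow_represents)
    show "cond_le M X T S"
      unfolding cond_le_iff[OF t S]
    proof
      fix x assume "x \<in> X"
      then have "AE w in M. w \<in> t x \<longrightarrow> w \<in> u x" "AE w in M. w \<in> t x \<longrightarrow> w \<in> v x"
        using T(2) cond_le_iff[OF t P] cond_le_iff[OF t Q] by blast+
      then show "AE w in M. w \<in> t x \<longrightarrow> w \<in> u x \<inter> v x"
        by eventually_elim blast
    qed
  qed (use represents_cond_Pow P Q S in auto)
  with S show ?thesis
    by simp
qed

lemma cond_disjoint_iff:
  assumes "represents P u" "represents Q v"
  shows "cond_disjoint M X P Q \<longleftrightarrow> (\<forall>x\<in>X. AE w in M. \<not> (w \<in> u x \<and> w \<in> v x))"
proof
  note meet = represents_meet[OF assms]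
  show "\<forall>x\<in>X. AE w in M. \<not> (w \<in> u x \<and> w \<in> v x)" if "cond_disjoint M X P Q"
  proof -
    have "cond_le M X (P \<sqinter>\<^bsub>cond_order M X\<^esub> Q) (srestr M X {})"
      using that meet represents_bot cond_le_iff[OF represents_bot represents_bot]
      unfolding cond_disjoint_def by simp
    then show ?thesis
      unfolding cond_le_iff[OF meet represents_bot] by simp
  qed
  show "cond_disjoint M X P Q" if "\<forall>x\<in>X. AE w in M. \<not> (w \<in> u x \<and> w \<in> v x)"
    unfolding cond_disjoint_def
    by (rule represents_unique[OF meet represents_bot]) (use that in auto)
qed

text \<open>The complement is specified by \<open>P \<squnion> Q = X\<close> and \<open>P \<sqinter> Q = X|\<emptyset>\<close>, and these two equations, read pointwise,
  force the characteristic function of \<open>Q\<close> to be \<open>space M - u x\<close> almost everywhere.\<close>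

lemma represents_compl:
  assumes P: "represents P u"
  shows "represents (cond_compl M X P) (\<lambda>x. space M - u x)"
proof -
  have "extensional_family (\<lambda>x. space M - u x)"
  proof (rule extensional_familyI)
    show "space M - u x \<in> sets M" if "x \<in> X" for x
      using represents_sets[OF P that] by blast
    fix x y C assume *: "x \<in> X" "y \<in> X" "C \<in> sets M" "AE w in M. w \<in> C \<longrightarrow> x w = y w"
    have "AE w in M. w \<in> C \<longrightarrow> y w = x w"
      using *(4) by eventually_elim auto
    then have "AE w in M. w \<in> C \<longrightarrow> w \<in> u y \<longrightarrow> w \<in> u x"
      using extensional_familyD[OF represents_extensional[OF P] *(2,1,3)] by blast
    then show "AE w in M. w \<in> C \<longrightarrow> w \<in> space M - u x \<longrightarrow> w \<in> space M - u y"
      by eventually_elim auto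
  qed
  then obtain S where S: "represents S (\<lambda>x. space M - u x)"
    by (rule extensional_family_represents)
  have "cond_compl M X P = S"
    unfolding cond_compl_def
  proof (rule the_equality)
    have "P \<squnion>\<^bsub>cond_order M X\<^esub> S = srestr M X (space M)"
    proof (rule represents_unique[OF represents_join[OF P S] represents_top])
      fix x assume "x \<in> X"
      then have "u x \<subseteq> space M"
        using represents_sets[OF P] sets.sets_into_space by blast
      then show "AE w in M. w \<in> u x \<union> (space M - u x) \<longleftrightarrow> w \<in> space M"
        by (intro AE_I2) blast
    qed
    moreover have "P \<sqinter>\<^bsub>cond_order M X\<^esub> S = srestr M X {}"
      by (rule represents_unique[OF represents_meet[OF P S] represents_bot]) auto
    ultimately show "S \<in> cond_Pow M X \<and> P \<squnion>\<^bsub>cond_order M X\<^esub> S = srestr M X (space M) \<and>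
        P \<sqinter>\<^bsub>cond_order M X\<^esub> S = srestr M X {}"
      using represents_cond_Pow[OF S] by blast
    fix Q assume Q: "Q \<in> cond_Pow M X \<and> P \<squnion>\<^bsub>cond_order M X\<^esub> Q = srestr M X (space M) \<and>
        P \<sqinter>\<^bsub>cond_order M X\<^esub> Q = srestr M X {}"
    then obtain v where v: "represents Q v"
      using cond_Pow_represents by blast
    have "cond_disjoint M X P Q"
      using Q unfolding cond_disjoint_def by blast
    note disj = this[unfolded cond_disjoint_iff[OF P v]]
    have "cond_le M X (srestr M X (space M)) (P \<squnion>\<^bsub>cond_order M X\<^esub> Q)"
      using Q cond_le_iff[OF represents_top represents_top] by simp
    note cov = this[unfolded cond_le_iff[OF represents_top represents_join[OF P v]]]
    show "Q = S"
    proof (rule represents_unique[OF v S])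
      fix x assume x: "x \<in> X"
      show "AE w in M. w \<in> v x \<longleftrightarrow> w \<in> space M - u x"
        using bspec[OF disj x] bspec[OF cov x] AE_space by eventually_elim blast
    qed
  qed
  with S show ?thesis
    by simp
qed

text \<open>The cells \<open>A k\<close> are disjoint, so membership of \<open>x\<close> in the concatenation on \<open>C\<close> can be tested on
  each \<open>C \<inter> A k\<close> separately, and there it is membership in \<open>V k|B k\<close>.\<close>

lemma represents_concat:
  assumes A: "mpartition M A" and V: "\<And>k. V k \<subseteq> X" "\<And>k. stable_set M (V k)" "\<And>k. B k \<in> sets M"
    and u: "\<And>k. represents (srestr M (V k) (B k)) (u k)"
  shows "represents (srestr M (glue_sets A V) (\<Union>k. A k \<inter> B k)) (\<lambda>x. \<Union>k. A k \<inter> u k x)"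
proof -
  define W where "W = {y \<in> X. \<forall>k. \<exists>v\<in>V k. AE w in M. w \<in> A k \<longrightarrow> y w = v w}"
  have As: "A k \<in> sets M" for k
    using A unfolding mpartition_def by blast
  have Bs: "(\<Union>k. A k \<inter> B k) \<in> sets M"
    using As V(3) by blast
  have W: "stable_set M W" "srestr M (glue_sets A V) (\<Union>k. A k \<inter> B k) = srestr M W (\<Union>k. A k \<inter> B k)"
    unfolding W_def by (rule glue_sets_representatives[OF stable_X A V(1,2)] Bs)+
  have disj: "j = k" if "w \<in> A j" "w \<in> A k" for w j k
    using A that unfolding mpartition_def disjoint_family_on_def by blast
  have "covers M (srestr M W (\<Union>k. A k \<inter> B k)) C x \<longleftrightarrow> (AE w in M. w \<in> C \<longrightarrow> w \<in> (\<Union>k. A k \<inter> u k x))"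
    if x: "x \<in> X" and C: "C \<in> sets M" for x C
  proof -
    have piece: "(AE w in M. w \<in> C \<inter> A k \<longrightarrow> w \<in> u k x) \<longleftrightarrow>
        (AE w in M. w \<in> C \<inter> A k \<longrightarrow> w \<in> B k) \<and> (\<exists>v\<in>V k. AE w in M. w \<in> C \<inter> A k \<longrightarrow> x w = v w)" for k
      using represents_covers[OF u x, of "C \<inter> A k" k] covers_srestr[OF V(3)] C As[of k] by blast
    have split: "(AE w in M. w \<in> C \<longrightarrow> w \<in> (\<Union>k. A k \<inter> S k)) \<longleftrightarrow>
        (\<forall>k. AE w in M. w \<in> C \<inter> A k \<longrightarrow> w \<in> S k)" for S
    proof -
      have "(w \<in> C \<longrightarrow> w \<in> (\<Union>k. A k \<inter> S k)) \<longleftrightarrow> (\<forall>k. w \<in> C \<inter> A k \<longrightarrow> w \<in> S k)"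
        if "w \<in> space M" for w
      proof -
        obtain k where k: "w \<in> A k"
          using A \<open>w \<in> space M\<close> unfolding mpartition_def by blast
        then have "w \<in> A j \<longleftrightarrow> j = k" for j
          using disj by blast
        then show ?thesis
          by simp
      qed
      then have "(AE w in M. w \<in> C \<longrightarrow> w \<in> (\<Union>k. A k \<inter> S k)) \<longleftrightarrow>
          (AE w in M. \<forall>k. w \<in> C \<inter> A k \<longrightarrow> w \<in> S k)"
        by (intro AE_cong) auto
      then show ?thesis
        by (simp only: AE_all_countable)
    qed
    have "(\<exists>y\<in>W. AE w in M. w \<in> C \<longrightarrow> x w = y w) \<longleftrightarrow>
        (\<forall>k. \<exists>v\<in>V k. AE w in M. w \<in> C \<inter> A k \<longrightarrow> x w = v w)"
    proof
      assume "\<exists>y\<in>W. AE w in M. w \<in> C \<longrightarrow> x w = y w"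
      then obtain y where y: "y \<in> W" "AE w in M. w \<in> C \<longrightarrow> x w = y w"
        by blast
      show "\<forall>k. \<exists>v\<in>V k. AE w in M. w \<in> C \<inter> A k \<longrightarrow> x w = v w"
      proof
        fix k
        obtain v where v: "v \<in> V k" "AE w in M. w \<in> A k \<longrightarrow> y w = v w"
          using y(1) unfolding W_def by blast
        have "AE w in M. w \<in> C \<inter> A k \<longrightarrow> x w = v w"
          using y(2) v(2) by eventually_elim auto
        with v(1) show "\<exists>v\<in>V k. AE w in M. w \<in> C \<inter> A k \<longrightarrow> x w = v w"
          by blast
      qed
    next
      assume "\<forall>k. \<exists>v\<in>V k. AE w in M. w \<in> C \<inter> A k \<longrightarrow> x w = v w"
      then have "\<forall>k. \<exists>v. v \<in> V k \<and> (AE w in M. w \<in> C \<inter> A k \<longrightarrow> x w = v w)"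
        by blast
      then obtain v where v: "\<And>k. v k \<in> V k" "\<And>k. AE w in M. w \<in> C \<inter> A k \<longrightarrow> x w = v k w"
        by metis
      obtain y where y: "y \<in> X" "\<And>k. AE w in M. w \<in> A k \<longrightarrow> y w = v k w"
        using stable_set_glue[OF stable_X A, of v] v(1) V(1) by blast
      have "y \<in> W"
        using y v(1) unfolding W_def by blast
      moreover have "AE w in M. \<forall>k. (w \<in> C \<inter> A k \<longrightarrow> x w = v k w) \<and> (w \<in> A k \<longrightarrow> y w = v k w)"
        using v(2) y(2) by (simp add: AE_all_countable)
      then have "AE w in M. w \<in> C \<longrightarrow> x w = y w"
        using AE_space
      proof eventually_elim
        case (elim w)
        then obtain k where "w \<in> A k"
          using A unfolding mpartition_def by blast
        with elim show ?case
          by (metis IntI)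
      qed
      ultimately show "\<exists>y\<in>W. AE w in M. w \<in> C \<longrightarrow> x w = y w"
        by blast
    qed
    then show ?thesis
      unfolding covers_srestr[OF Bs] split using piece by blast
  qed
  moreover have "srestr M W (\<Union>k. A k \<inter> B k) \<in> cond_Pow M X"
    using W(1) Bs by (intro cond_PowI) (auto simp: W_def)
  moreover have "(\<Union>k. A k \<inter> u k x) \<in> sets M" if "x \<in> X" for x
    using As represents_sets[OF u that] by blast
  ultimately show ?thesis
    unfolding W(2) represents_def by blast
qed

section \<open>Stable Dynkin systems\<close>

text \<open>This lemma and the next one express closedness under concatenations by characteristic functions,
  without mentioning representations \<open>V k|B k\<close>.\<close>

lemma stable_collection_concat:
  assumes \<X>: "stable_collection M X \<X>" and A: "mpartition M A"
    and P: "\<And>k. P k \<in> \<X>" "\<And>k. represents (P k) (u k)"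
    and R: "represents R (\<lambda>x. \<Union>k. A k \<inter> u k x)"
  shows "R \<in> \<X>"
proof -
  have "\<exists>V B. V \<subseteq> X \<and> stable_set M V \<and> B \<in> sets M \<and> P k = srestr M V B" for k
    using represents_cond_Pow[OF P(2)] by (metis cond_PowE)
  then obtain V B where V: "\<And>k. V k \<subseteq> X" "\<And>k. stable_set M (V k)" "\<And>k. B k \<in> sets M"
    "\<And>k. P k = srestr M (V k) (B k)"
    by metis
  have "srestr M (glue_sets A V) (\<Union>k. A k \<inter> B k) \<in> \<X>"
  proof -
    have "\<forall>k. V k \<subseteq> X \<and> stable_set M (V k) \<and> B k \<in> sets M \<and> srestr M (V k) (B k) \<in> \<X>"
      using V P(1) by simp
    then show ?thesis
      using \<X> A unfolding stable_collection_def by simp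
  qed
  moreover have "represents (srestr M (glue_sets A V) (\<Union>k. A k \<inter> B k)) (\<lambda>x. \<Union>k. A k \<inter> u k x)"
    using represents_concat[OF A V(1-3)] P(2) V(4) by simp
  then have "srestr M (glue_sets A V) (\<Union>k. A k \<inter> B k) = R"
    using R by (rule represents_unique) simp
  ultimately show ?thesis
    by simp
qed

lemma stable_collectionI:
  assumes "\<X> \<subseteq> cond_Pow M X" "\<X> \<noteq> {}"
    and concat: "\<And>A P u R. mpartition M A \<Longrightarrow> (\<And>k. P k \<in> \<X>) \<Longrightarrow> (\<And>k. represents (P k) (u k)) \<Longrightarrow>
      represents R (\<lambda>x. \<Union>k. A k \<inter> u k x) \<Longrightarrow> R \<in> \<X>"
  shows "stable_collection M X \<X>"
  unfolding stable_collection_def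
proof (intro conjI allI impI)
  fix A B and V :: "nat \<Rightarrow> ('w \<Rightarrow> 'e) set"
  assume *: "mpartition M A \<and> (\<forall>k. V k \<subseteq> X \<and> stable_set M (V k) \<and> B k \<in> sets M \<and>
    srestr M (V k) (B k) \<in> \<X>)"
  then have "\<forall>k. \<exists>u. represents (srestr M (V k) (B k)) u"
    by (metis cond_PowI cond_Pow_represents)
  then obtain u where u: "\<And>k. represents (srestr M (V k) (B k)) (u k)"
    by metis
  show "srestr M (glue_sets A V) (\<Union>k. A k \<inter> B k) \<in> \<X>"
    by (rule concat[OF _ _ u represents_concat[OF _ _ _ _ u]]) (use * in auto)
qed (use assms in auto)

lemma stable_dynkin_cond_Pow: "stable_dynkin M X (cond_Pow M X)"
proof -
  have top: "srestr M X (space M) \<in> cond_Pow M X"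
    using represents_cond_Pow represents_top by blast
  have "stable_collection M X (cond_Pow M X)"
    by (rule stable_collectionI) (use top represents_cond_Pow in auto)
  moreover have "cond_compl M X P \<in> cond_Pow M X" if "P \<in> cond_Pow M X" for P
    using that represents_compl represents_cond_Pow by (metis cond_Pow_represents)
  moreover have "\<Squnion>\<^bsub>cond_order M X\<^esub> (range P) \<in> cond_Pow M X" if "range P \<subseteq> cond_Pow M X" for P :: "nat \<Rightarrow> _"
  proof -
    have "\<forall>k. \<exists>u. represents (P k) u"
      using that by (metis cond_Pow_represents range_subsetD)
    then obtain u where "\<And>k. represents (P k) (u k)"
      by metis
    then show ?thesis
      using represents_Sup represents_cond_Pow by blast
  qed
  ultimately show ?thesis
    unfolding stable_dynkin_def using top by blast
qed

lemma stable_dynkin_Inter: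
  assumes "\<S> \<noteq> {}" "\<And>\<X>. \<X> \<in> \<S> \<Longrightarrow> stable_dynkin M X \<X>"
  shows "stable_dynkin M X (\<Inter>\<S>)"
proof -
  have sub: "\<Inter>\<S> \<subseteq> cond_Pow M X"
    using assms unfolding stable_dynkin_def stable_collection_def by blast
  moreover have top: "srestr M X (space M) \<in> \<Inter>\<S>"
    using assms unfolding stable_dynkin_def by blast
  moreover have "R \<in> \<Inter>\<S>" if "mpartition M A" "\<And>k. P k \<in> \<Inter>\<S>" "\<And>k. represents (P k) (u k)"
      "represents R (\<lambda>x. \<Union>k. A k \<inter> u k x)" for A P u R
    using that assms(2) stable_collection_concat[OF _ that(1) _ that(3,4)]
    unfolding stable_dynkin_def by blast
  ultimately have "stable_collection M X (\<Inter>\<S>)"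
    by (intro stable_collectionI) blast+
  moreover have "cond_compl M X P \<in> \<Inter>\<S>" if "P \<in> \<Inter>\<S>" for P
    using that assms(2) unfolding stable_dynkin_def by blast
  moreover have "\<Squnion>\<^bsub>cond_order M X\<^esub> (range P) \<in> \<Inter>\<S>"
    if "range P \<subseteq> \<Inter>\<S> \<and> (\<forall>i j :: nat. i \<noteq> j \<longrightarrow> cond_disjoint M X (P i) (P j))" for P
  proof
    fix \<X> assume "\<X> \<in> \<S>"
    moreover from this have "range P \<subseteq> \<X>"
      using that by blast
    ultimately show "\<Squnion>\<^bsub>cond_order M X\<^esub> (range P) \<in> \<X>"
      using that assms(2)[of \<X>] unfolding stable_dynkin_def by blast
  qed
  ultimately show ?thesis
    unfolding stable_dynkin_def using top by blast
qed

lemma gen_stable_dynkin: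
  assumes "\<E> \<subseteq> cond_Pow M X"
  shows "stable_dynkin M X (gen_stable_dynkin M X \<E>)" "\<E> \<subseteq> gen_stable_dynkin M X \<E>"
    "stable_dynkin M X \<X> \<Longrightarrow> \<E> \<subseteq> \<X> \<Longrightarrow> gen_stable_dynkin M X \<E> \<subseteq> \<X>"
proof -
  show "stable_dynkin M X (gen_stable_dynkin M X \<E>)"
    unfolding gen_stable_dynkin_def
    by (rule stable_dynkin_Inter) (use stable_dynkin_cond_Pow assms in auto)
qed (auto simp: gen_stable_dynkin_def)

context
  fixes \<D>
  assumes \<D>: "stable_dynkin M X \<D>"
begin

lemma stable_dynkin_represents:
  assumes "P \<in> \<D>"
  obtains u where "represents P u"
  using assms \<D> cond_Pow_represents unfolding stable_dynkin_def stable_collection_def by blast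

lemma stable_dynkin_compl: "P \<in> \<D> \<Longrightarrow> cond_compl M X P \<in> \<D>"
  using \<D> unfolding stable_dynkin_def by blast

lemma stable_dynkin_top: "srestr M X (space M) \<in> \<D>"
  using \<D> unfolding stable_dynkin_def by blast

lemma stable_dynkin_bot: "srestr M X {} \<in> \<D>"
proof -
  have "cond_compl M X (srestr M X (space M)) = srestr M X {}"
    by (rule represents_unique[OF represents_compl[OF represents_top] represents_bot]) simp
  then show ?thesis
    using stable_dynkin_compl[OF stable_dynkin_top] by simp
qed

lemma stable_dynkin_disjoint_Sup:
  assumes P: "\<And>k::nat. P k \<in> \<D>" "\<And>k. represents (P k) (u k)"
    and disj: "\<And>i j x. i \<noteq> j \<Longrightarrow> x \<in> X \<Longrightarrow> AE w in M. \<not> (w \<in> u i x \<and> w \<in> u j x)"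
    and R: "represents R v" "\<And>x. x \<in> X \<Longrightarrow> AE w in M. w \<in> v x \<longleftrightarrow> w \<in> (\<Union>k. u k x)"
  shows "R \<in> \<D>"
proof -
  have "cond_disjoint M X (P i) (P j)" if "i \<noteq> j" for i j
    using disj[OF that] cond_disjoint_iff[OF P(2) P(2)] by blast
  then have "\<Squnion>\<^bsub>cond_order M X\<^esub> (range P) \<in> \<D>"
    using P(1) \<D> unfolding stable_dynkin_def by blast
  moreover have "R = \<Squnion>\<^bsub>cond_order M X\<^esub> (range P)"
    by (rule represents_unique[OF R(1) represents_Sup[of P u, OF P(2)] R(2)])
  ultimately show ?thesis
    by simp
qed

text \<open>For \<open>Q\<close> contained in \<open>P\<close>, the difference \<open>P \<sqinter> Q\<^sup>c\<close> is the complement of the disjoint union of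
  \<open>P\<^sup>c\<close> and \<open>Q\<close>.\<close>

lemma stable_dynkin_diff:
  assumes P: "P \<in> \<D>" "represents P u" and Q: "Q \<in> \<D>" "represents Q v"
    and le: "\<And>x. x \<in> X \<Longrightarrow> AE w in M. w \<in> v x \<longrightarrow> w \<in> u x"
    and R: "represents R r" "\<And>x. x \<in> X \<Longrightarrow> AE w in M. w \<in> r x \<longleftrightarrow> w \<in> u x \<and> w \<notin> v x"
  shows "R \<in> \<D>"
proof -
  define S where "S = cond_compl M X P \<squnion>\<^bsub>cond_order M X\<^esub> Q"
  have S: "represents S (\<lambda>x. (space M - u x) \<union> v x)"
    unfolding S_def by (intro represents_join represents_compl P Q)
  define T where "T k = (if k = 0 then cond_compl M X P else if k = 1 then Q else srestr M X {})"
    for k :: nat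
  define t where "t k x = (if k = 0 then space M - u x else if k = 1 then v x else {})"
    for k :: nat and x
  have "S \<in> \<D>"
  proof (rule stable_dynkin_disjoint_Sup[where P = T and u = t])
    show "T k \<in> \<D>" for k
      using P Q stable_dynkin_bot stable_dynkin_compl unfolding T_def by auto
    have "represents (srestr M X {}) (t k)" if "k \<noteq> 0" "k \<noteq> 1" for k
      using that represents_bot unfolding t_def by simp
    then show "represents (T k) (t k)" for k
      using represents_compl[OF P(2)] Q(2) unfolding T_def t_def by auto
    show "AE w in M. \<not> (w \<in> t i x \<and> w \<in> t j x)" if "i \<noteq> j" "x \<in> X" for i j x
      using le[OF that(2)] by eventually_elim (use that in \<open>auto simp: t_def split: if_splits\<close>)
    have "(\<Union>k. t k x) = (space M - u x) \<union> v x" for x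
    proof -
      have "(\<Union>k. t k x) = t 0 x \<union> t 1 x"
        by (auto simp: t_def split: if_splits)
      then show ?thesis
        by (simp add: t_def)
    qed
    then show "AE w in M. w \<in> (space M - u x) \<union> v x \<longleftrightarrow> w \<in> (\<Union>k. t k x)" for x
      by simp
  qed (rule S)
  then have "cond_compl M X S \<in> \<D>"
    by (rule stable_dynkin_compl)
  moreover have "R = cond_compl M X S"
  proof (rule represents_unique[OF R(1) represents_compl[OF S]])
    fix x assume "x \<in> X"
    then have "AE w in M. w \<in> r x \<longleftrightarrow> w \<in> u x \<and> w \<notin> v x"
      by (rule R(2))
    then show "AE w in M. w \<in> r x \<longleftrightarrow> w \<in> space M - ((space M - u x) \<union> v x)"
      using AE_space by eventually_elim blast
  qed
  ultimately show ?thesis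
    by simp
qed

text \<open>Intersection with \<open>P\<close> distributes over concatenations and countable unions, preserves disjointness and turns
  the complement of \<open>Q\<close> into the difference of \<open>P\<close> and \<open>P \<sqinter> Q\<close>.\<close>

lemma stable_dynkin_meet_slice:
  assumes P: "P \<in> \<D>"
  shows "stable_dynkin M X {Q \<in> cond_Pow M X. P \<sqinter>\<^bsub>cond_order M X\<^esub> Q \<in> \<D>}"
    (is "stable_dynkin M X ?S")
proof -
  obtain u where u: "represents P u"
    using P by (rule stable_dynkin_represents)
  have coll: "stable_collection M X \<D>"
    using \<D> unfolding stable_dynkin_def by blast
  have top: "srestr M X (space M) \<in> ?S"
  proof -
    have "P \<sqinter>\<^bsub>cond_order M X\<^esub> srestr M X (space M) = P"
      by (rule represents_unique[OF represents_meet[OF u represents_top] u], intro AE_I2) blast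
    then show ?thesis
      using P represents_cond_Pow[OF represents_top] by simp
  qed
  have "stable_collection M X ?S"
  proof (rule stable_collectionI)
    fix A Q v R
    assume A: "mpartition M A" and Q: "\<And>k. Q k \<in> ?S" "\<And>k. represents (Q k) (v k)"
      and R: "represents R (\<lambda>x. \<Union>k. A k \<inter> v k x)"
    have eq: "u x \<inter> (\<Union>k. A k \<inter> v k x) = (\<Union>k. A k \<inter> (u x \<inter> v k x))" for x
      by blast
    have "P \<sqinter>\<^bsub>cond_order M X\<^esub> R \<in> \<D>"
    proof (rule stable_collection_concat[OF coll A])
      show "P \<sqinter>\<^bsub>cond_order M X\<^esub> Q k \<in> \<D>" for k
        using Q(1) by blast
      show "represents (P \<sqinter>\<^bsub>cond_order M X\<^esub> Q k) (\<lambda>x. u x \<inter> v k x)" for k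
        by (rule represents_meet[OF u Q(2)])
      show "represents (P \<sqinter>\<^bsub>cond_order M X\<^esub> R) (\<lambda>x. \<Union>k. A k \<inter> (u x \<inter> v k x))"
        using represents_meet[OF u R] unfolding eq .
    qed
    then show "R \<in> ?S"
      using represents_cond_Pow[OF R] by blast
  qed (use top in auto)
  moreover have "cond_compl M X Q \<in> ?S" if Q: "Q \<in> ?S" for Q
  proof -
    obtain v where v: "represents Q v"
      using Q cond_Pow_represents by blast
    have "P \<sqinter>\<^bsub>cond_order M X\<^esub> cond_compl M X Q \<in> \<D>"
      by (rule stable_dynkin_diff[OF P u _ represents_meet[OF u v] _
            represents_meet[OF u represents_compl[OF v]]])
        (use Q in \<open>auto intro: AE_I2\<close>)
    then show ?thesis
      using represents_cond_Pow[OF represents_compl[OF v]] by blast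
  qed
  moreover have "\<Squnion>\<^bsub>cond_order M X\<^esub> (range Q) \<in> ?S"
    if Q: "range Q \<subseteq> ?S \<and> (\<forall>i j :: nat. i \<noteq> j \<longrightarrow> cond_disjoint M X (Q i) (Q j))" for Q
  proof -
    have QS: "Q k \<in> ?S" for k
      using Q by blast
    then have "\<forall>k. \<exists>v. represents (Q k) v"
      using cond_Pow_represents by blast
    then obtain v where v: "\<And>k. represents (Q k) (v k)"
      by metis
    have "P \<sqinter>\<^bsub>cond_order M X\<^esub> \<Squnion>\<^bsub>cond_order M X\<^esub> (range Q) \<in> \<D>"
    proof (rule stable_dynkin_disjoint_Sup)
      show "P \<sqinter>\<^bsub>cond_order M X\<^esub> Q k \<in> \<D>" for k
        using QS by blast
      show "represents (P \<sqinter>\<^bsub>cond_order M X\<^esub> Q k) (\<lambda>x. u x \<inter> v k x)" for k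
        by (rule represents_meet[OF u v])
      show "represents (P \<sqinter>\<^bsub>cond_order M X\<^esub> \<Squnion>\<^bsub>cond_order M X\<^esub> (range Q)) (\<lambda>x. u x \<inter> (\<Union>k. v k x))"
        by (rule represents_meet[OF u represents_Sup[of Q v, OF v]])
      fix i j x assume ij: "i \<noteq> (j::nat)" and x: "x \<in> X"
      have "AE w in M. \<not> (w \<in> v i x \<and> w \<in> v j x)"
        using Q ij x cond_disjoint_iff[OF v v] by blast
      then show "AE w in M. \<not> (w \<in> u x \<inter> v i x \<and> w \<in> u x \<inter> v j x)"
        by eventually_elim auto
    qed auto
    then show ?thesis
      using represents_cond_Pow[OF represents_Sup[of Q v, OF v]] by blast
  qed
  ultimately show ?thesis
    unfolding stable_dynkin_def using top by blast
qed

text \<open>A sequence \<open>P n\<close> has the same supremum as the disjoint sequence \<open>P n \<sqinter> R n\<close>, where \<open>R n\<close> is the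
  complement of \<open>P 0 \<squnion> \<dots> \<squnion> P (n - 1)\<close>.  The \<open>R n\<close> are finite intersections of complements and
  so belong to the system.\<close>

lemma stable_dynkin_Int_sigma_algebra:
  assumes meet: "\<And>P Q. P \<in> \<D> \<Longrightarrow> Q \<in> \<D> \<Longrightarrow> P \<sqinter>\<^bsub>cond_order M X\<^esub> Q \<in> \<D>"
  shows "stable_sigma_algebra M X \<D>"
proof -
  have "\<Squnion>\<^bsub>cond_order M X\<^esub> (range P) \<in> \<D>" if P: "range P \<subseteq> \<D>" for P :: "nat \<Rightarrow> _"
  proof -
    have PD: "P k \<in> \<D>" for k
      using P by blast
    then have "\<forall>k. \<exists>u. represents (P k) u"
      using stable_dynkin_represents by metis
    then obtain u where u: "\<And>k. represents (P k) (u k)"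
      by metis
    have rest: "\<exists>R\<in>\<D>. represents R (\<lambda>x. space M - (\<Union>i<n. u i x))" for n
    proof (induction n)
      case 0
      show ?case
        using stable_dynkin_top represents_top by auto
    next
      case (Suc n)
      then obtain R where R: "R \<in> \<D>" "represents R (\<lambda>x. space M - (\<Union>i<n. u i x))"
        by blast
      have eq: "(space M - (\<Union>i<n. u i x)) \<inter> (space M - u n x) = space M - (\<Union>i<Suc n. u i x)" for x
        by (auto simp: lessThan_Suc)
      have "represents (R \<sqinter>\<^bsub>cond_order M X\<^esub> cond_compl M X (P n)) (\<lambda>x. space M - (\<Union>i<Suc n. u i x))"
        using represents_meet[OF R(2) represents_compl[OF u[of n]]] unfolding eq .
      moreover have "R \<sqinter>\<^bsub>cond_order M X\<^esub> cond_compl M X (P n) \<in> \<D>"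
        by (intro meet R stable_dynkin_compl PD)
      ultimately show ?case
        by blast
    qed
    then obtain R where R: "\<And>n. R n \<in> \<D>" "\<And>n. represents (R n) (\<lambda>x. space M - (\<Union>i<n. u i x))"
      by metis
    show ?thesis
    proof (rule stable_dynkin_disjoint_Sup)
      show "P n \<sqinter>\<^bsub>cond_order M X\<^esub> R n \<in> \<D>" for n
        by (intro meet PD R)
      show "represents (P n \<sqinter>\<^bsub>cond_order M X\<^esub> R n) (\<lambda>x. u n x \<inter> (space M - (\<Union>i<n. u i x)))" for n
        by (rule represents_meet[OF u R(2)])
      show "represents (\<Squnion>\<^bsub>cond_order M X\<^esub> (range P)) (\<lambda>x. \<Union>k. u k x)"
        by (rule represents_Sup[of P u, OF u])
      show "AE w in M. \<not> (w \<in> u i x \<inter> (space M - (\<Union>k<i. u k x)) \<and> w \<in> u j x \<inter> (space M - (\<Union>k<j. u k x)))"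
        if "i \<noteq> j" for i j x
        using that by (cases i j rule: linorder_cases) auto
      fix x assume x: "x \<in> X"
      have "u n x \<inter> (space M - (\<Union>i<n. u i x)) = disjointed (\<lambda>k. u k x) n" for n
        using sets.sets_into_space[OF represents_sets[OF u x]]
        unfolding disjointed_def by (auto simp: atLeast0LessThan)
      then show "AE w in M. w \<in> (\<Union>k. u k x) \<longleftrightarrow> w \<in> (\<Union>n. u n x \<inter> (space M - (\<Union>i<n. u i x)))"
        by (simp add: UN_disjointed_eq)
    qed
  qed
  then show ?thesis
    using \<D> unfolding stable_sigma_algebra_def stable_dynkin_def by blast
qed

end

text \<open>The slice argument is used twice: for \<open>R\<close> in \<open>\<E>\<close> the slice at \<open>R\<close> contains \<open>\<E>\<close>, hence all of \<open>\<D>(\<E>)\<close>;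
  by symmetry the slice at any \<open>P\<close> in \<open>\<D>(\<E>)\<close> then contains \<open>\<E>\<close>, hence again all of \<open>\<D>(\<E>)\<close>.\<close>

lemma gen_stable_dynkin_meet:
  assumes \<E>: "\<E> \<subseteq> cond_Pow M X"
    and meet: "\<And>P Q. P \<in> \<E> \<Longrightarrow> Q \<in> \<E> \<Longrightarrow> P \<sqinter>\<^bsub>cond_order M X\<^esub> Q \<in> \<E>"
    and P: "P \<in> gen_stable_dynkin M X \<E>" and Q: "Q \<in> gen_stable_dynkin M X \<E>"
  shows "P \<sqinter>\<^bsub>cond_order M X\<^esub> Q \<in> gen_stable_dynkin M X \<E>"
proof -
  note gen = gen_stable_dynkin[OF \<E>]
  let ?S = "\<lambda>P. {Q \<in> cond_Pow M X. P \<sqinter>\<^bsub>cond_order M X\<^esub> Q \<in> gen_stable_dynkin M X \<E>}"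
  have slice: "gen_stable_dynkin M X \<E> \<subseteq> ?S R"
    if "R \<in> gen_stable_dynkin M X \<E>" "\<And>Q. Q \<in> \<E> \<Longrightarrow> R \<sqinter>\<^bsub>cond_order M X\<^esub> Q \<in> gen_stable_dynkin M X \<E>" for R
    by (rule gen(3)[OF stable_dynkin_meet_slice[OF gen(1) that(1)]]) (use that(2) \<E> in blast)
  have "R \<sqinter>\<^bsub>cond_order M X\<^esub> P \<in> gen_stable_dynkin M X \<E>" if "R \<in> \<E>" for R
    using slice[of R] that gen(2) meet P by blast
  then have "P \<sqinter>\<^bsub>cond_order M X\<^esub> R \<in> gen_stable_dynkin M X \<E>" if "R \<in> \<E>" for R
    using that by (simp add: meet_def insert_commute[of P R])
  then show ?thesis
    using slice[OF P] Q by blast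
qed

end

theorem theorem3p5:
  fixes M :: "'w measure" and X :: "('w \<Rightarrow> 'e) set"
    and \<E> :: "('w set \<times> ('w \<Rightarrow> 'e)) set set set"
  assumes "prob_space M" and "complete_measure M"
    and "stable_set M X"
    and "stable_collection M X \<E>"
    and "\<And>\<F>. finite \<F> \<Longrightarrow> \<F> \<noteq> {} \<Longrightarrow> \<F> \<subseteq> \<E> \<Longrightarrow> \<Sqinter>\<^bsub>cond_order M X\<^esub> \<F> \<in> \<E>"
  shows "gen_stable_sigma_algebra M X \<E> = gen_stable_dynkin M X \<E>"
proof -
  interpret stable_space M X
    using assms(1,3) by (simp add: stable_space_def stable_space_axioms_def)
  have \<E>: "\<E> \<subseteq> cond_Pow M X"
    using assms(4) unfolding stable_collection_def by blast
  have meet: "P \<sqinter>\<^bsub>cond_order M X\<^esub> Q \<in> \<E>" if "P \<in> \<E>" "Q \<in> \<E>" for P Q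
    unfolding meet_def using that by (intro assms(5)) auto
  have "stable_sigma_algebra M X (gen_stable_dynkin M X \<E>)"
    using gen_stable_dynkin(1)[OF \<E>] gen_stable_dynkin_meet[OF \<E> meet]
    by (rule stable_dynkin_Int_sigma_algebra)
  then have "gen_stable_sigma_algebra M X \<E> \<subseteq> gen_stable_dynkin M X \<E>"
    using gen_stable_dynkin(2)[OF \<E>] unfolding gen_stable_sigma_algebra_def by blast
  moreover have "stable_dynkin M X \<X>" if "stable_sigma_algebra M X \<X>" for \<X>
    using that unfolding stable_sigma_algebra_def stable_dynkin_def by blast
  then have "gen_stable_dynkin M X \<E> \<subseteq> gen_stable_sigma_algebra M X \<E>"
    unfolding gen_stable_sigma_algebra_def gen_stable_dynkin_def by blast
  ultimately show ?thesis
    by blast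
qed

end
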